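(* Let $n\ge 1$ and let the edges of the balanced complete bipartite graph $K_{n,n}$ be coloured $2$-locally. Then the vertex set of $K_{n,n}$ can be partitioned into the vertex sets of at most $3$ monochromatic paths.
   Context: An edge colouring is an arbitrary assignment of colours to edges (it need not be proper), and the total number of colours used is not restricted. An edge colouring of a graph is $2$-local if every vertex is incident to edges of at most $2$ distinct colours. A path is monochromatic if all its edges have the same colour; single vertices and single edges count as (monochromatic) paths. *)

theory Defs
  imports "Graph_Theory.Graph_Theory" "HOL-Library.Disjoint_Sets"
begin

text \<open>
  Graphs are symmetric loop-free digraphs without parallel arcs. The two arcs \<open>(u, v)\<close> and
  \<open>(v, u)\<close> form a single undirected edge \<open>{u, v}\<close>, and it is these edges that are coloured: a
  colouring is a function on vertex sets of which only the values on edges matter. The type of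
  colours is arbitrary, so the number of colours is unrestricted.
\<close>

definition edges :: "('a, 'b) pre_digraph \<Rightarrow> 'a set set" where
  "edges G = {{u, v} | u v. (u, v) \<in> arcs_ends G}"

text \<open>The finiteness condition guards against \<open>card\<close> being 0 on infinite sets.\<close>

definition local_colouring :: "nat \<Rightarrow> ('a, 'b) pre_digraph \<Rightarrow> ('a set \<Rightarrow> 'c) \<Rightarrow> bool" where
  "local_colouring k G c \<longleftrightarrow>
     (\<forall>v \<in> verts G. finite (c ` {e \<in> edges G. v \<in> e}) \<and> card (c ` {e \<in> edges G. v \<in> e}) \<le> k)"

definition path_edges :: "'a vwalk \<Rightarrow> 'a set set" where
  "path_edges p = {{u, v} | u v. (u, v) \<in> set (vwalk_arcs p)}"

definition monochromatic_path :: "('a, 'b) pre_digraph \<Rightarrow> ('a set \<Rightarrow> 'c) \<Rightarrow> 'a vwalk \<Rightarrow> bool" where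
  "monochromatic_path G c p \<longleftrightarrow>
     vpath p G \<and> (\<forall>e \<in> path_edges p. \<forall>f \<in> path_edges p. c e = c f)"

end

theory Submission
  imports Defs
begin

text \<open>
  A depth-first search for colour \<open>k\<close> splits a balanced pair of vertex sets into a path of colour
  \<open>k\<close> and two sets \<open>U\<close>, \<open>W\<close> of equal size without edges of colour \<open>k\<close> between them; counting on the
  two sides shows that \<open>U \<union> W\<close> carries two balanced complete bipartite graphs avoiding \<open>k\<close>. If the
  edges of colour other than \<open>k\<close> at every vertex have a single colour, both are monochromatic, so they
  have Hamiltonian paths and three paths suffice. In particular this settles two colours.

  In general give every vertex a palette of two colours containing those of its edges. Palettes on
  opposite sides intersect, and unless the previous case applies only a few configurations remain. In
  each of them most edges have a forced colour, and three paths are found by combining the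
  depth-first splitting, merging paths of equal colour through vertices with only one relevant colour,
  and counting.
\<close>

section \<open>Covering by monochromatic paths\<close>

text \<open>The budget of three is exactly what one split uses: a path and two blocks. If blocks
  still carry several colours, or further vertices wait elsewhere, a path must be saved, so most of
  the work lies in threading two blocks of one colour into a single path. Hence Hamiltonian paths
  come with prescribed ends, and single vertices or edges are reserved as links.

  Two-colour palettes can be pictured as edges of a graph on the colours. Two palettes that meet
  either are equal or share one colour, which is then forced; only equal palettes leave a choice.
  Every palette on one side meets every palette on the other, and such families of edges are few:
  all edges share an endpoint; or one side uses only \<open>{h, i}\<close> and
  \<open>{h, j}\<close>, facing edges through \<open>h\<close> and \<open>{i, j}\<close>; or both
  sides use the three edges of a triangle; or one side has two disjoint edges, which confines the
  other side to a 4-cycle. Palettes are padded to exactly two colours so that this list stays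
  short.\<close>

definition ham_path :: "('c \<Rightarrow> 'a \<Rightarrow> 'a \<Rightarrow> bool) \<Rightarrow> 'c \<Rightarrow> 'a \<Rightarrow> 'a set \<Rightarrow> 'a \<Rightarrow> bool" where
  "ham_path E k u X v \<longleftrightarrow>
     (\<exists>p. p \<noteq> [] \<and> distinct p \<and> successively (E k) p \<and> hd p = u \<and> last p = v \<and> set p = X)"

text \<open>A bound instead of an exact count makes empty blocks harmless: constructions need not
  check whether a chosen piece has any vertices.\<close>

definition coverable :: "('c \<Rightarrow> 'a \<Rightarrow> 'a \<Rightarrow> bool) \<Rightarrow> nat \<Rightarrow> 'a set \<Rightarrow> bool" where
  "coverable E m X \<longleftrightarrow>
     (\<exists>P. partition_on X P \<and> finite P \<and> card P \<le> m \<and> (\<forall>Y \<in> P. \<exists>k u v. ham_path E k u Y v))"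

definition complete_in :: "('a \<Rightarrow> 'a \<Rightarrow> bool) \<Rightarrow> 'a set \<Rightarrow> 'a set \<Rightarrow> bool" where
  "complete_in R X Y \<longleftrightarrow> (\<forall>x \<in> X. \<forall>y \<in> Y. R x y)"

lemma complete_inD: "complete_in R X Y \<Longrightarrow> x \<in> X \<Longrightarrow> y \<in> Y \<Longrightarrow> R x y"
  by (simp add: complete_in_def)

lemma complete_in_mono: "complete_in R X Y \<Longrightarrow> X' \<subseteq> X \<Longrightarrow> Y' \<subseteq> Y \<Longrightarrow> complete_in R X' Y'"
  by (auto simp: complete_in_def)

lemma complete_in_Un:
  "complete_in R (X \<union> X') Y \<longleftrightarrow> complete_in R X Y \<and> complete_in R X' Y"
  "complete_in R X (Y \<union> Y') \<longleftrightarrow> complete_in R X Y \<and> complete_in R X Y'"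
  by (auto simp: complete_in_def)

lemma complete_in_empty [simp]: "complete_in R {} Y" "complete_in R X {}"
  by (auto simp: complete_in_def)

lemma ham_path_singleton: "ham_path E k u {u} u"
  unfolding ham_path_def by (rule exI[of _ "[u]"]) auto

lemma ham_path_append:
  assumes "ham_path E k u X v" "ham_path E k w Y z" "E k v w" "X \<inter> Y = {}"
  shows "ham_path E k u (X \<union> Y) z"
proof -
  obtain p q where "p \<noteq> []" "distinct p" "successively (E k) p" "hd p = u" "last p = v" "set p = X"
    and "q \<noteq> []" "distinct q" "successively (E k) q" "hd q = w" "last q = z" "set q = Y"
    using assms(1,2) unfolding ham_path_def by blast
  then show ?thesis
    using assms(3,4) unfolding ham_path_def
    by (intro exI[of _ "p @ q"]) (auto simp: successively_append_iff)
qed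

lemma coverable_empty: "coverable E m {}"
  unfolding coverable_def by (rule exI[of _ "{}"]) (auto simp: partition_on_def)

lemma ham_path_nonempty: "ham_path E k u X v \<Longrightarrow> X \<noteq> {}"
  unfolding ham_path_def by force

lemma coverable_ham_path: "ham_path E k u X v \<Longrightarrow> coverable E 1 X"
  unfolding coverable_def
  by (rule exI[of _ "{X}"]) (auto simp: partition_on_def dest: ham_path_nonempty)

lemma coverable_Un:
  assumes "coverable E l X" "coverable E m Y" "X \<inter> Y = {}"
  shows "coverable E (l + m) (X \<union> Y)"
proof -
  obtain P Q where P: "partition_on X P" "finite P" "card P \<le> l"
      "\<forall>Y \<in> P. \<exists>k u v. ham_path E k u Y v"
    and Q: "partition_on Y Q" "finite Q" "card Q \<le> m"
      "\<forall>Y \<in> Q. \<exists>k u v. ham_path E k u Y v"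
    using assms(1,2) unfolding coverable_def by blast
  have "card (P \<union> Q) \<le> l + m"
    using card_Un_le[of P Q] P(3) Q(3) by linarith
  moreover have "partition_on (X \<union> Y) (P \<union> Q)"
    using P(1) Q(1) assms(3) unfolding partition_on_def
    by (auto intro!: disjoint_union)
  ultimately show ?thesis
    using P Q unfolding coverable_def by (intro exI[of _ "P \<union> Q"]) auto
qed

lemma coverable_1_1:
  assumes "coverable E 1 X" "coverable E 1 Y" "X \<inter> Y = {}" "Z = X \<union> Y"
  shows "coverable E 2 Z"
  using coverable_Un[OF assms(1-3)] assms(4) by (simp add: numeral_2_eq_2)

lemma coverable_1_2:
  assumes "coverable E 1 X" "coverable E 2 Y" "X \<inter> Y = {}" "Z = X \<union> Y"
  shows "coverable E 3 Z"
  using coverable_Un[OF assms(1-3)] assms(4) by (simp add: numeral_3_eq_3 numeral_2_eq_2)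

lemma coverable_1_1_1:
  assumes "coverable E 1 X" "coverable E 1 Y" "coverable E 1 W"
    "X \<inter> Y = {}" "X \<inter> W = {}" "Y \<inter> W = {}" "Z = X \<union> Y \<union> W"
  shows "coverable E 3 Z"
proof -
  have "coverable E 2 (Y \<union> W)"
    by (rule coverable_1_1[OF assms(2,3,6)]) auto
  then show ?thesis
    by (rule coverable_1_2[OF assms(1)]) (use assms(4,5,7) in auto)
qed

section \<open>Depth-first splitting\<close>

text \<open>
  A search state consists of the stack \<open>p\<close>, the unvisited vertices \<open>U\<close> and the finished vertices \<open>W\<close>.
  One vertex moves at a time, so at some moment \<open>U\<close> and \<open>W\<close> have the same size.
\<close>

lemma depth_first_split:
  fixes R :: "'a \<Rightarrow> 'a \<Rightarrow> bool"
  assumes "finite V"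
  shows "\<exists>p U W. distinct p \<and> successively R p \<and> set p \<union> U \<union> W = V \<and>
           set p \<inter> U = {} \<and> set p \<inter> W = {} \<and> U \<inter> W = {} \<and> card U = card W \<and>
           (\<forall>u \<in> U. \<forall>w \<in> W. \<not> R u w)"
proof -
  let ?st = "\<lambda>p U W. distinct p \<and> successively R p \<and> set p \<union> U \<union> W = V \<and>
           set p \<inter> U = {} \<and> set p \<inter> W = {} \<and> U \<inter> W = {} \<and>
           (\<forall>u \<in> U. \<forall>w \<in> W. \<not> R u w)"
  have "\<exists>p U W. ?st p U W \<and> card U = card W" if "?st p U W" "card W \<le> card U" for p U W
    using that
  \<comment> \<open>Pushing a vertex takes 2 from the first summand and adds 1 to the second;
    popping takes 1 from the second. So every move lowers the measure by one, and it lowers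
    \<open>card U - card W\<close> by one as well, so equality cannot be skipped.\<close>
  proof (induction "2 * card U + length p" arbitrary: p U W rule: less_induct)
    case less
    have fin: "finite U" "finite W" 
      using less.prems(1) assms by (auto intro: finite_subset)
    show ?case
    proof (cases "card U = card W")
      case True
      then show ?thesis using less.prems by blast
    next
      case False
      then have lt: "card W < card U" using less.prems(2) by simp
      then have "U \<noteq> {}" by auto
      show ?thesis
      proof (cases p)
        case Nil
        obtain u where u: "u \<in> U" using \<open>U \<noteq> {}\<close> by blast
        have c: "card (U - {u}) = card U - 1" using u fin by simp
        show ?thesis
          by (rule less.hyps[of "U - {u}" "[u]" W])
            (use less.prems u Nil lt c in auto)
      next
        case (Cons v q)
        show ?thesis
        proof (cases "\<exists>u \<in> U. R u v")
          case True
          then obtain u where u: "u \<in> U" "R u v" by blast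
          have c: "card (U - {u}) = card U - 1" using u fin by simp
          show ?thesis
            by (rule less.hyps[of "U - {u}" "u # p" W])
              (use less.prems u Cons lt c in auto)
        next
          case nb: False
          have c: "card (insert v W) = card W + 1"
            using less.prems fin Cons by simp
          have "?st q U (insert v W)"
            using less.prems(1) nb Cons by (auto simp: successively_Cons)
          then show ?thesis
            by (rule less.hyps[rotated]) (use Cons lt c in simp_all)
        qed
      qed
    qed
  qed
  from this[of "[]" V "{}"] obtain p U W where "?st p U W" "card U = card W"
    by auto
  then show ?thesis by blast
qed

lemma successively_neighbour:
  assumes "successively R p" "x \<in> set p" "length p \<ge> 2" "\<And>u v. R u v \<Longrightarrow> R v u"
  shows "\<exists>y \<in> set p. R x y"
  using assms(1-3)
proof (induction p rule: induct_list012)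
  case (3 y z zs)
  then show ?case
    using assms(4) by (cases zs) auto
qed auto

text \<open>Vertices are peeled off in pairs, one from each side, so the counts stay equal; even
  length puts the two ends on opposite sides.\<close>

lemma successively_alternating:
  assumes "successively R p" "distinct p" "even (length p)" "set p \<subseteq> A \<union> B" "A \<inter> B = {}"
    and "\<And>u v. R u v \<Longrightarrow> u \<in> A \<and> v \<in> B \<or> u \<in> B \<and> v \<in> A"
  shows "card (set p \<inter> A) = card (set p \<inter> B) \<and>
    (p \<noteq> [] \<longrightarrow> hd p \<in> A \<and> last p \<in> B \<or> hd p \<in> B \<and> last p \<in> A)"
  using assms(1-4)
proof (induction p rule: induct_list012)
  case (3 x y zs)
  have IH: "card (set zs \<inter> A) = card (set zs \<inter> B)"
    "zs \<noteq> [] \<longrightarrow> hd zs \<in> A \<and> last zs \<in> B \<or> hd zs \<in> B \<and> last zs \<in> A"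
    using 3 by (auto simp: successively_Cons)
  have xy: "x \<in> A \<and> y \<in> B \<or> x \<in> B \<and> y \<in> A"
    using 3 assms(6) by auto
  have yz: "zs \<noteq> [] \<longrightarrow> y \<in> A \<and> hd zs \<in> B \<or> y \<in> B \<and> hd zs \<in> A"
    using 3 assms(6) by (auto simp: successively_Cons)
  have "card (set (x # y # zs) \<inter> C) = card (set zs \<inter> C) + 1"
    if "x \<in> C \<and> y \<notin> C \<or> y \<in> C \<and> x \<notin> C" for C
    using that 3(4) by (auto simp: Int_insert_left card_insert_if)
  note step = this
  have "card (set (x # y # zs) \<inter> A) = card (set (x # y # zs) \<inter> B)"
    using IH(1) step[of A] step[of B] xy assms(5) by (metis IntI emptyE)
  moreover have "hd (x # y # zs) \<in> A \<and> last (x # y # zs) \<in> B \<or>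
      hd (x # y # zs) \<in> B \<and> last (x # y # zs) \<in> A"
    using IH(2) xy yz assms(5) by (cases "zs = []") auto
  ultimately show ?case by blast
qed auto

section \<open>Two-sided colourings\<close>

text \<open>One relation per colour lets the depth-first split be applied to \<open>E k\<close>
  directly. The axioms are symmetric in \<open>A\<close> and \<open>B\<close>, so each one-sided
  lemma has a mirror image through \<open>swap_sides\<close>.\<close>

locale bipartite_colouring =
  fixes E :: "'c \<Rightarrow> 'a \<Rightarrow> 'a \<Rightarrow> bool" and A B :: "'a set"
  assumes finite_A: "finite A" and finite_B: "finite B"
    and disjoint_AB: "A \<inter> B = {}"
    and E_sym: "E k u v \<Longrightarrow> E k v u"
    and E_bip: "E k u v \<Longrightarrow> u \<in> A \<and> v \<in> B \<or> u \<in> B \<and> v \<in> A"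
    and E_total: "u \<in> A \<Longrightarrow> v \<in> B \<Longrightarrow> \<exists>k. E k u v"
    and E_unique: "E k u v \<Longrightarrow> E l u v \<Longrightarrow> k = l"
begin

lemma swap_sides: "bipartite_colouring E B A"
proof
  show "finite B" "finite A" "B \<inter> A = {}"
    using finite_A finite_B disjoint_AB by auto
qed (use E_sym E_bip E_total E_unique in \<open>blast+\<close>)

lemma complete_in_commute: "complete_in (E k) X Y \<longleftrightarrow> complete_in (E k) Y X"
  using E_sym by (auto simp: complete_in_def)

section \<open>Hamiltonian paths in complete blocks\<close>

lemma ham_path_reverse: "ham_path E k u X v \<Longrightarrow> ham_path E k v X u"
proof -
  assume "ham_path E k u X v"
  then obtain p where p: "p \<noteq> []" "distinct p" "successively (E k) p" "hd p = u" "last p = v" "set p = X"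
    unfolding ham_path_def by blast
  have "successively (\<lambda>x y. E k y x) p"
    using p(3) by (rule successively_mono) (rule E_sym)
  then show ?thesis
    unfolding ham_path_def using p
    by (intro exI[of _ "rev p"]) (auto simp: hd_rev last_rev)
qed

lemma ham_path_edge:
  assumes "E k u v"
  shows "ham_path E k u {u, v} v"
proof -
  have "u \<noteq> v" using E_bip[OF assms] disjoint_AB by auto
  then show ?thesis
    unfolding ham_path_def using assms by (intro exI[of _ "[u, v]"]) auto
qed

text \<open>Both ends are prescribed so that the path can be spliced to others. Start with
  \<open>u\<close> and some \<open>y\<close> other than \<open>v\<close>; what is left is a smaller
  balanced block still containing \<open>v\<close>, entered from \<open>y\<close> at any remaining
  \<open>x\<close>.\<close>

lemma complete_ham_path:
  assumes "X \<subseteq> A" "Y \<subseteq> B" "card X = card Y" "complete_in (E k) X Y" "u \<in> X" "v \<in> Y"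
  shows "ham_path E k u (X \<union> Y) v"
  using assms
proof (induction "card X" arbitrary: X Y u)
  case 0
  then show ?case
    using finite_A by (metis card_0_eq emptyE finite_subset)
next
  case (Suc n)
  have fin: "finite X" "finite Y"
    using Suc.prems finite_A finite_B by (auto intro: finite_subset)
  have uv: "E k u v"
    using Suc.prems by (auto simp: complete_in_def)
  show ?case
  proof (cases "n = 0")
    case True
    then have "X = {u}" "Y = {v}"
      using Suc.hyps(2) Suc.prems fin by (metis One_nat_def card_1_singletonE singletonD)+
    then show ?thesis
      using ham_path_edge[OF uv] by (simp add: insert_commute)
  next
    case False
    have cX: "card (X - {u}) = n" and cY: "card (Y - {v}) = n"
      using Suc.hyps(2) Suc.prems fin by auto
    obtain x where x: "x \<in> X" "x \<noteq> u"
      using cX False by (metis card.empty all_not_in_conv Diff_iff singletonI)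
    obtain y where y: "y \<in> Y" "y \<noteq> v"
      using cY False by (metis card.empty all_not_in_conv Diff_iff singletonI)
    have h1: "ham_path E k x ((X - {u}) \<union> (Y - {y})) v"
      by (rule Suc.hyps(1)) (use Suc.prems Suc.hyps(2) fin x y in \<open>auto simp: complete_in_def\<close>)
    have h2: "ham_path E k u {u, y} y"
      using Suc.prems y by (intro ham_path_edge) (auto simp: complete_in_def)
    have "ham_path E k u ({u, y} \<union> ((X - {u}) \<union> (Y - {y}))) v"
    proof (rule ham_path_append[OF h2 h1])
      show "E k y x"
        using E_sym Suc.prems x y by (auto simp: complete_in_def)
    qed (use disjoint_AB Suc.prems y in auto)
    moreover have "{u, y} \<union> ((X - {u}) \<union> (Y - {y})) = X \<union> Y"
      using Suc.prems y by auto
    ultimately show ?thesis by simp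
  qed
qed

text \<open>The surplus vertex forces both ends into \<open>X\<close>. A vertex \<open>x\<close>
  other than \<open>u\<close> is set aside and appended to a path of the balanced rest.\<close>

lemma complete_ham_path_odd:
  assumes "X \<subseteq> A" "Y \<subseteq> B" "card X = card Y + 1" "complete_in (E k) X Y" "u \<in> X"
  shows "\<exists>v \<in> X. ham_path E k u (X \<union> Y) v"
proof (cases "Y = {}")
  case True
  then have "X = {u}"
    using assms by (metis One_nat_def add.left_neutral card.empty card_1_singletonE singletonD)
  then show ?thesis
    using True ham_path_singleton by auto
next
  case False
  have fin: "finite X" "finite Y"
    using assms finite_A finite_B by (auto intro: finite_subset)
  obtain y where y: "y \<in> Y" using False by blast
  then have "card (X - {u}) \<noteq> 0"
    using assms fin False by simp
  then obtain x where x: "x \<in> X" "x \<noteq> u"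
    by (metis card.empty all_not_in_conv Diff_iff singletonI)
  have "ham_path E k u ((X - {x}) \<union> Y) y"
    by (rule complete_ham_path) (use assms x y fin in \<open>auto simp: complete_in_def\<close>)
  then have "ham_path E k u (((X - {x}) \<union> Y) \<union> {x}) x"
  proof (rule ham_path_append[OF _ ham_path_singleton])
    show "E k y x" using assms x y E_sym by (auto simp: complete_in_def)
  qed (use assms x disjoint_AB in auto)
  moreover have "((X - {x}) \<union> Y) \<union> {x} = X \<union> Y"
    using x by auto
  ultimately show ?thesis using x by auto
qed

lemma balanced_empty_iff:
  assumes "X \<subseteq> A" "Y \<subseteq> B" "card X = card Y"
  shows "X = {} \<longleftrightarrow> Y = {}"
  using assms finite_A finite_B by (metis card_0_eq card.empty finite_subset)

lemma complete_coverable: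
  assumes "X \<subseteq> A" "Y \<subseteq> B" "card X = card Y" "complete_in (E k) X Y"
  shows "coverable E 1 (X \<union> Y)"
proof (cases "X = {}")
  case True
  then show ?thesis
    using balanced_empty_iff[OF assms(1-3)] by (simp add: coverable_empty)
next
  case False
  then obtain u v where "u \<in> X" "v \<in> Y"
    using balanced_empty_iff[OF assms(1-3)] by blast
  then show ?thesis
    using complete_ham_path assms coverable_ham_path by metis
qed

text \<open>The linking edge fixes the inner ends of the two Hamiltonian paths. It is demanded only
  when both blocks are nonempty, since otherwise there is nothing to join.\<close>

lemma joined_coverable:
  assumes "X \<subseteq> A" "Y \<subseteq> B" "card X = card Y" "complete_in (E k) X Y"
    and "X' \<subseteq> A" "Y' \<subseteq> B" "card X' = card Y'" "complete_in (E k) X' Y'"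
    and "X \<inter> X' = {}" "Y \<inter> Y' = {}"
    and "X \<noteq> {} \<Longrightarrow> X' \<noteq> {} \<Longrightarrow> \<exists>y \<in> Y. \<exists>x \<in> X'. E k y x"
  shows "coverable E 1 (X \<union> Y \<union> (X' \<union> Y'))"
proof (cases "X = {} \<or> X' = {}")
  case True
  then show ?thesis
    using balanced_empty_iff[OF assms(1-3)] balanced_empty_iff[OF assms(5-7)]
      complete_coverable[OF assms(1-4)] complete_coverable[OF assms(5-8)] by auto
next
  case False
  then obtain y x where yx: "y \<in> Y" "x \<in> X'" "E k y x" using assms(11) by blast
  obtain u v where uv: "u \<in> X" "v \<in> Y'"
    using False balanced_empty_iff[OF assms(5-7)] by blast
  have "ham_path E k u (X \<union> Y \<union> (X' \<union> Y')) v"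
    using disjoint_AB assms(1,2,5,6,9,10)
    by (intro ham_path_append[OF complete_ham_path[OF assms(1-4) uv(1) yx(1)]
          complete_ham_path[OF assms(5-8) yx(2) uv(2)] yx(3)]) auto
  then show ?thesis by (rule coverable_ham_path)
qed

text \<open>All vertices of \<open>X\<close> see \<open>Y1\<close> and \<open>Y2\<close> alike, so
  any cut of \<open>X\<close> into parts of the sizes of \<open>Y1\<close> and \<open>Y2\<close>
  yields two monochromatic balanced blocks.\<close>

lemma split_coverable:
  assumes "X \<subseteq> A" "Y1 \<subseteq> B" "Y2 \<subseteq> B" "Y1 \<inter> Y2 = {}" "card X = card Y1 + card Y2"
    and "complete_in (E i) X Y1" "complete_in (E j) X Y2"
  shows "coverable E 2 (X \<union> (Y1 \<union> Y2))"
proof -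
  have "finite X" using assms finite_A finite_subset by blast
  have "card Y1 \<le> card X" using assms(5) by simp
  then obtain X1 where X1: "X1 \<subseteq> X" "card X1 = card Y1"
    by (rule obtain_subset_with_card_n)
  have "card (X - X1) = card Y2"
    using X1 assms \<open>finite X\<close> by (simp add: card_Diff_subset finite_subset)
  then have c2: "coverable E 1 ((X - X1) \<union> Y2)"
    using assms by (intro complete_coverable[where k = j]) (auto simp: complete_in_def)
  have c1: "coverable E 1 (X1 \<union> Y1)"
    using assms X1 by (intro complete_coverable[where k = i]) (auto simp: complete_in_def)
  have "(X1 \<union> Y1) \<inter> ((X - X1) \<union> Y2) = {}"
    using assms(1-4) X1(1) disjoint_AB by blast
  then show ?thesis
    by (rule coverable_1_1[OF c1 c2]) (use X1(1) in auto)
qed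

text \<open>The blocks are taken crosswise: unvisited vertices of one side with finished vertices of
  the other. The path's ends on opposite sides allow extension later, and the fact that each path
  vertex has a \<open>k\<close>-neighbour on the path shows that a vertex without
  \<open>k\<close>-edges lies in a block.\<close>

lemma colour_split:
  assumes "X \<subseteq> A" "Y \<subseteq> B" "card X = card Y"
  obtains PX X1 X2 PY Y1 Y2 where
    "X = PX \<union> X1 \<union> X2" "PX \<inter> X1 = {}" "PX \<inter> X2 = {}" "X1 \<inter> X2 = {}"
    "Y = PY \<union> Y1 \<union> Y2" "PY \<inter> Y1 = {}" "PY \<inter> Y2 = {}" "Y1 \<inter> Y2 = {}"
    "card X1 = card Y1" "card X2 = card Y2"
    "PX = {} \<and> PY = {} \<or> (\<exists>u \<in> PX. \<exists>v \<in> PY. ham_path E k u (PX \<union> PY) v)"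
    "\<And>x. x \<in> PX \<Longrightarrow> \<exists>y \<in> PY. E k x y" "\<And>y. y \<in> PY \<Longrightarrow> \<exists>x \<in> PX. E k x y"
    "\<And>x y. x \<in> X1 \<Longrightarrow> y \<in> Y1 \<Longrightarrow> \<not> E k x y" "\<And>x y. x \<in> X2 \<Longrightarrow> y \<in> Y2 \<Longrightarrow> \<not> E k x y"
    "coverable E 1 (PX \<union> PY)"
proof -
  have fin: "finite X" "finite Y"
    using assms finite_A finite_B by (auto intro: finite_subset)
  have XY: "X \<inter> Y = {}" using assms disjoint_AB by blast
  obtain p U W where p: "distinct p" "successively (E k) p" "set p \<union> U \<union> W = X \<union> Y"
      "set p \<inter> U = {}" "set p \<inter> W = {}" "U \<inter> W = {}" "card U = card W"
      "\<forall>u \<in> U. \<forall>w \<in> W. \<not> E k u w"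
    using depth_first_split[of "X \<union> Y" "E k"] fin by auto
  have finUW: "finite U" "finite W"
    using p(3) fin by (metis finite_Un)+
  have "card (X \<union> Y) = length p + card U + card W"
  proof -
    have "card (set p \<union> U \<union> W) = card (set p) + card U + card W"
      using p(4-6) finUW by (subst card_Un_disjoint; (subst card_Un_disjoint)?; auto)
    then show ?thesis using p(1,3) distinct_card by metis
  qed
  moreover have "card (X \<union> Y) = 2 * card X"
    using card_Un_disjoint[OF fin XY] assms by simp
  \<comment> \<open>The total is even and \<open>U\<close>, \<open>W\<close> together contribute an
    even number.\<close>
  ultimately have "even (length p)" using p(7) by presburger
  have pX: "set p \<inter> A = set p \<inter> X" and pY: "set p \<inter> B = set p \<inter> Y"
    using p(3) assms(1,2) disjoint_AB by blast+
  have sub: "set p \<subseteq> A \<union> B" using p(3) assms by blast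
  have inX: "x \<in> A \<longleftrightarrow> x \<in> X" and inY: "x \<in> B \<longleftrightarrow> x \<in> Y" if "x \<in> set p" for x
    using that pX pY by blast+
  have alt: "card (set p \<inter> X) = card (set p \<inter> Y)"
      "p \<noteq> [] \<longrightarrow> hd p \<in> X \<and> last p \<in> Y \<or> hd p \<in> Y \<and> last p \<in> X"
    using successively_alternating[OF p(2,1) \<open>even (length p)\<close> _ disjoint_AB E_bip[of k]] sub
    unfolding pX pY using inX inY hd_in_set[of p] last_in_set[of p] by metis+
  have dec: "card Z = card (set p \<inter> Z) + card (U \<inter> Z) + card (W \<inter> Z)"
    if "finite Z" "Z \<subseteq> X \<union> Y" for Z
  proof -
    have "Z = (set p \<inter> Z) \<union> (U \<inter> Z) \<union> (W \<inter> Z)" using that p(3) by blast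
    then have "card Z = card ((set p \<inter> Z) \<union> (U \<inter> Z) \<union> (W \<inter> Z))" by simp
    also have "\<dots> = card (set p \<inter> Z) + card (U \<inter> Z) + card (W \<inter> Z)"
      using p(4-6) that(1) by (subst card_Un_disjoint; (subst card_Un_disjoint)?; auto)
    finally show ?thesis .
  qed
  have "U - X = U \<inter> Y" "W - X = W \<inter> Y"
    using p(3) XY by blast+
  then have "card U = card (U \<inter> X) + card (U \<inter> Y)" "card W = card (W \<inter> X) + card (W \<inter> Y)"
    using card_Int_Diff[OF finUW(1), of X] card_Int_Diff[OF finUW(2), of X] by simp_all
  moreover have "card (U \<inter> X) + card (W \<inter> X) = card (U \<inter> Y) + card (W \<inter> Y)"
    using dec[of X] dec[of Y] fin alt(1) assms(3) by auto
  \<comment> \<open>Writing both \<open>card U = card W\<close> and the equality of the two sides in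
    terms of the four intersections, the sum and difference of the equations give the crosswise
    equalities.\<close>
  ultimately have bal: "card (U \<inter> X) = card (W \<inter> Y)" "card (W \<inter> X) = card (U \<inter> Y)"
    using p(7) by linarith+
  have hp: "ham_path E k (hd p) (set p \<inter> X \<union> set p \<inter> Y) (last p)" if "p \<noteq> []"
  proof -
    have "set p \<inter> X \<union> set p \<inter> Y = set p" using p(3) by blast
    then show ?thesis using that p(1,2) unfolding ham_path_def by auto
  qed
  have ends: "set p \<inter> X = {} \<and> set p \<inter> Y = {} \<or>
      (\<exists>u \<in> set p \<inter> X. \<exists>v \<in> set p \<inter> Y. ham_path E k u (set p \<inter> X \<union> set p \<inter> Y) v)"
    using hp ham_path_reverse[OF hp] alt(2) by (cases "p = []") auto
  have nb: "\<exists>y \<in> set p. E k x y" if "x \<in> set p" for x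
    using successively_neighbour[OF p(2) that _ E_sym] that \<open>even (length p)\<close>
    by (cases p; cases "tl p") auto
  show ?thesis
  proof (rule that[of "set p \<inter> X" "U \<inter> X" "W \<inter> X" "set p \<inter> Y" "W \<inter> Y" "U \<inter> Y"])
    show "\<And>x. x \<in> set p \<inter> X \<Longrightarrow> \<exists>y \<in> set p \<inter> Y. E k x y"
      using nb E_bip pY disjoint_AB assms(1) by blast
    show "\<And>y. y \<in> set p \<inter> Y \<Longrightarrow> \<exists>x \<in> set p \<inter> X. E k x y"
      using nb E_bip E_sym pX disjoint_AB assms(2) by blast
    show "coverable E 1 (set p \<inter> X \<union> set p \<inter> Y)"
      using hp coverable_ham_path coverable_empty by (cases "p = []") auto
    show "X = set p \<inter> X \<union> U \<inter> X \<union> W \<inter> X" "Y = set p \<inter> Y \<union> W \<inter> Y \<union> U \<inter> Y"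
      using p(3) by blast+
    show "\<And>x y. x \<in> U \<inter> X \<Longrightarrow> y \<in> W \<inter> Y \<Longrightarrow> \<not> E k x y"
      "\<And>x y. x \<in> W \<inter> X \<Longrightarrow> y \<in> U \<inter> Y \<Longrightarrow> \<not> E k x y"
      using p(8) E_sym by blast+
  qed (use p(4-6) bal ends in auto)
qed

lemma star_coverable:
  assumes "X \<subseteq> A" "Y \<subseteq> B" "card X = card Y"
    and X: "\<And>x y y' i j. x \<in> X \<Longrightarrow> y \<in> Y \<Longrightarrow> y' \<in> Y \<Longrightarrow> E i x y \<Longrightarrow> E j x y' \<Longrightarrow> i \<noteq> k \<Longrightarrow> j \<noteq> k \<Longrightarrow> i = j"
    and Y: "\<And>x x' y i j. x \<in> X \<Longrightarrow> x' \<in> X \<Longrightarrow> y \<in> Y \<Longrightarrow> E i x y \<Longrightarrow> E j x' y \<Longrightarrow> i \<noteq> k \<Longrightarrow> j \<noteq> k \<Longrightarrow> i = j"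
  shows "coverable E 3 (X \<union> Y)"
proof -
  have mono: "coverable E 1 (U \<union> W)"
    if UW: "U \<subseteq> X" "W \<subseteq> Y" "card U = card W" "\<And>u w. u \<in> U \<Longrightarrow> w \<in> W \<Longrightarrow> \<not> E k u w" for U W
  proof -
    have "\<exists>l. complete_in (E l) U W"
    proof (cases "U = {} \<or> W = {}")
      case False
      then obtain u w where uw: "u \<in> U" "w \<in> W" by blast
      then obtain l where l: "E l u w" using E_total UW(1,2) assms(1,2) by blast
      have "E l x y" if xy: "x \<in> U" "y \<in> W" for x y
      proof -
        obtain i j where ij: "E i x w" "E j x y"
          using E_total UW(1,2) assms(1,2) xy uw by (meson subsetD)
        \<comment> \<open>The colour of \<open>u w\<close> is carried to \<open>x y\<close> through
          \<open>x w\<close>, which shares a vertex with each.\<close>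
        have "l = i" using Y[OF _ _ _ l ij(1)] UW l ij uw xy by blast
        moreover have "i = j" using X[OF _ _ _ ij] UW ij uw xy by blast
        ultimately show ?thesis using ij by simp
      qed
      then show ?thesis by (auto simp: complete_in_def)
    qed auto
    then show ?thesis using complete_coverable UW assms(1,2) by (meson order_trans)
  qed
  show ?thesis
  proof (rule colour_split[OF assms(1-3), where k = k], goal_cases)
    case (1 PX X1 X2 PY Y1 Y2)
    have "coverable E 1 (X1 \<union> Y1)" "coverable E 1 (X2 \<union> Y2)"
      by (rule mono; use 1 in auto)+
    then show ?case
      by (rule coverable_1_1_1[OF 1(16)]) (use 1(1-8) assms(1,2) disjoint_AB in blast)+
  qed
qed

section \<open>Two colours, and when two paths suffice\<close>

lemma two_colours_coverable:
  assumes "X \<subseteq> A" "Y \<subseteq> B" "card X = card Y"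
    and "\<And>x y. x \<in> X \<Longrightarrow> y \<in> Y \<Longrightarrow> E k x y \<or> E l x y"
  shows "coverable E 3 (X \<union> Y)"
  by (rule star_coverable[where k = k, OF assms(1-3)]) (use assms(4) E_unique in metis)+

text \<open>The vertex \<open>z\<close> has no \<open>k\<close>-edge, so it is not on the
  \<open>k\<close>-path but in one of the two \<open>l\<close>-blocks. All its edges to the other
  block have colour \<open>l\<close>, so the two blocks merge and one path is saved.\<close>

lemma two_colours_pure_left:
  assumes "X \<subseteq> A" "Y \<subseteq> B" "card X = card Y"
    and two: "\<And>x y. x \<in> X \<Longrightarrow> y \<in> Y \<Longrightarrow> E k x y \<or> E l x y"
    and z: "z \<in> X" "\<And>y. y \<in> Y \<Longrightarrow> \<not> E k z y"
  shows "coverable E 2 (X \<union> Y)"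
proof (rule colour_split[OF assms(1-3), where k = k], goal_cases)
  case (1 PX X1 X2 PY Y1 Y2)
  have sub: "X1 \<subseteq> A" "X2 \<subseteq> A" "Y1 \<subseteq> B" "Y2 \<subseteq> B"
    using 1(1,5) assms(1,2) by auto
  have c1: "complete_in (E l) X1 Y1" and c2: "complete_in (E l) X2 Y2"
    using 1(1,5,14,15) two unfolding complete_in_def by blast+
  have "z \<notin> PX" using 1(5,12) z by blast
  then consider "z \<in> X1" | "z \<in> X2" using z(1) 1(1) by blast
  then have "coverable E 1 (X1 \<union> Y1 \<union> (X2 \<union> Y2))"
  proof cases
    case z1: 1
    have "E l y z" if "y \<in> Y2" for y
      using two[OF z(1)] z(2) that 1(5) E_sym by blast
    have "coverable E 1 (X2 \<union> Y2 \<union> (X1 \<union> Y1))"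
    proof (rule joined_coverable[OF sub(2,4) 1(10) c2 sub(1,3) 1(9) c1])
      show "\<exists>y \<in> Y2. \<exists>x \<in> X1. E l y x" if "X2 \<noteq> {}"
        using balanced_empty_iff[OF sub(2,4) 1(10)] that \<open>\<And>y. y \<in> Y2 \<Longrightarrow> E l y z\<close> z1 by blast
    qed (use 1(4,8) in blast)+
    then show ?thesis by (simp add: Un_commute)
  next
    case z2: 2
    have "E l y z" if "y \<in> Y1" for y
      using two[OF z(1)] z(2) that 1(5) E_sym by blast
    show ?thesis
    proof (rule joined_coverable[OF sub(1,3) 1(9) c1 sub(2,4) 1(10) c2 1(4,8)])
      show "\<exists>y \<in> Y1. \<exists>x \<in> X2. E l y x" if "X1 \<noteq> {}"
        using balanced_empty_iff[OF sub(1,3) 1(9)] that \<open>\<And>y. y \<in> Y1 \<Longrightarrow> E l y z\<close> z2 by blast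
    qed
  qed
  then show ?case
    by (rule coverable_1_1[OF 1(16)]) (use 1(1-8) assms(1,2) disjoint_AB in blast)+
qed

lemma two_colours_pure_right:
  assumes "X \<subseteq> A" "Y \<subseteq> B" "card X = card Y"
    and "\<And>x y. x \<in> X \<Longrightarrow> y \<in> Y \<Longrightarrow> E k x y \<or> E l x y"
    and "z \<in> Y" "\<And>x. x \<in> X \<Longrightarrow> \<not> E k x z"
  shows "coverable E 2 (X \<union> Y)"
proof -
  interpret swap: bipartite_colouring E B A by (rule swap_sides)
  have "coverable E 2 (Y \<union> X)"
    by (rule swap.two_colours_pure_left[OF assms(2,1) assms(3)[symmetric] _ assms(5),
          where k = k and l = l]) (use assms(4,6) E_sym in blast)+
  then show ?thesis by (simp add: Un_commute)
qed

lemma two_colours_extra: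
  assumes "X \<subseteq> A" "Y \<subseteq> B" "card X = card Y"
    and two: "\<And>x y. x \<in> X \<Longrightarrow> y \<in> Y \<Longrightarrow> E k x y \<or> E l x y"
    and z: "z \<in> B" "z \<notin> Y" "complete_in (E l) X {z}"
  shows "coverable E 2 (X \<union> insert z Y)"
  \<comment> \<open>the two blocks of colour \<open>l\<close> are joined through \<open>z\<close>\<close>
proof (rule colour_split[OF assms(1-3), where k = k], goal_cases)
  case (1 PX X1 X2 PY Y1 Y2)
  interpret swap: bipartite_colouring E B A by (rule swap_sides)
  have sub: "X1 \<subseteq> A" "X2 \<subseteq> A" "Y1 \<subseteq> B" "Y2 \<subseteq> B"
    using 1(1,5) assms(1,2) by auto
  have c1: "complete_in (E l) X1 Y1" and c2: "complete_in (E l) X2 Y2"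
    using 1(1,5,14,15) two unfolding complete_in_def by blast+
  have "finite Y2" using sub finite_B finite_subset by blast
  have "\<exists>v \<in> insert z Y2. ham_path E l z (insert z Y2 \<union> X2) v"
  proof (rule swap.complete_ham_path_odd)
    show "complete_in (E l) (insert z Y2) X2"
      using c2 z(3) 1(1) E_sym unfolding complete_in_def by blast
  qed (use sub z 1(5,10) \<open>finite Y2\<close> in auto)
  then obtain v where v: "ham_path E l z (insert z Y2 \<union> X2) v" by blast
  have "coverable E 1 (X1 \<union> Y1 \<union> (insert z Y2 \<union> X2))"
  proof (cases "X1 = {}")
    case True
    then show ?thesis
      using v balanced_empty_iff[OF sub(1,3) 1(9)] coverable_ham_path by auto
  next
    case False
    then obtain x y where xy: "x \<in> X1" "y \<in> Y1"
      using balanced_empty_iff[OF sub(1,3) 1(9)] by blast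
    have "ham_path E l y (X1 \<union> Y1) x"
      by (rule ham_path_reverse[OF complete_ham_path]) (use sub 1 c1 xy in auto)
    moreover have "E l x z" using z(3) xy 1(1) by (auto simp: complete_in_def)
    moreover have "(X1 \<union> Y1) \<inter> (insert z Y2 \<union> X2) = {}"
      using 1(1-8) sub z disjoint_AB by blast
    ultimately show ?thesis
      using ham_path_append[OF _ v] coverable_ham_path by metis
  qed
  then show ?case
    by (rule coverable_1_1[OF 1(16)]) (use 1(1-8) z assms(1,2) disjoint_AB in blast)+
qed

text \<open>Give \<open>X2\<close> a part \<open>Z\<close> of \<open>Y\<close>. The
  \<open>i\<close>-block on \<open>X2\<close>, \<open>Z\<close> joins the one on \<open>X'\<close>,
  \<open>Y'\<close> because \<open>X'\<close> also sees \<open>Z\<close> in colour \<open>i\<close>;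
  \<open>X3\<close> with the rest of \<open>Y\<close> is the second path.\<close>

lemma merged_coverable:
  assumes "X \<subseteq> A" "Y \<subseteq> B" "card X = card Y" "X' \<subseteq> A" "Y' \<subseteq> B" "card X' = card Y'"
    and "X \<inter> X' = {}" "Y \<inter> Y' = {}"
    and "X = X2 \<union> X3" "X2 \<inter> X3 = {}" "complete_in (E i) X2 Y" "complete_in (E j) X3 Y"
    and "complete_in (E i) X' (Y \<union> Y')"
  shows "coverable E 2 (X \<union> Y \<union> (X' \<union> Y'))"
proof -
  have fin: "finite X" "finite Y"
    using assms finite_A finite_B by (auto intro: finite_subset)
  have cX: "card X = card X2 + card X3"
    using assms(9,10) fin by (simp add: card_Un_disjoint)
  then have "card X2 \<le> card Y" using assms(3) by simp
  then obtain Z where Z: "Z \<subseteq> Y" "card Z = card X2" "finite Z"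
    by (rule obtain_subset_with_card_n)
  have cZ: "card X3 = card (Y - Z)"
    using Z cX assms(3) by (simp add: card_Diff_subset)
  have sub: "X2 \<subseteq> A" "X3 \<subseteq> A" "Z \<subseteq> B" "Y - Z \<subseteq> B" using assms Z by auto
  have cc: "complete_in (E i) X2 Z" "complete_in (E i) X' Y'" "complete_in (E j) X3 (Y - Z)"
    using assms(11-13) Z by (auto simp: complete_in_def)
  have c1: "coverable E 1 (X2 \<union> Z \<union> (X' \<union> Y'))"
  proof (rule joined_coverable[OF sub(1,3) Z(2)[symmetric] cc(1) assms(4-6) cc(2)])
    assume "X2 \<noteq> {}" "X' \<noteq> {}"
    then show "\<exists>y \<in> Z. \<exists>x \<in> X'. E i y x"
      using balanced_empty_iff[OF sub(1,3) Z(2)[symmetric]] assms(13) Z(1) E_sym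
      unfolding complete_in_def by blast
  qed (use assms(7-9) Z(1) in blast)+
  have c2: "coverable E 1 (X3 \<union> (Y - Z))"
    by (rule complete_coverable[OF sub(2,4) cZ cc(3)])
  show ?thesis
  proof (rule coverable_1_1[OF c1 c2])
    show "(X2 \<union> Z \<union> (X' \<union> Y')) \<inter> (X3 \<union> (Y - Z)) = {}"
      using assms(2,4,5,7-10) Z(1) sub disjoint_AB by blast
  qed (use assms(9) Z(1) in blast)
qed

text \<open>Here \<open>A2\<close>, \<open>A3\<close>, \<open>B1\<close> stand for the palettes
  \<open>{h, i}\<close>, \<open>{h, j}\<close>, \<open>{i, j}\<close>, and \<open>B'\<close> for
  those containing \<open>h\<close>. After splitting off an \<open>h\<close>-path, a block meeting
  \<open>B'\<close> in some \<open>b\<close> must avoid the part of \<open>A\<close> that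
  \<open>b\<close> sees entirely in \<open>h\<close>; so it lies in \<open>A2\<close> or
  \<open>A3\<close> and is monochromatic. A block inside \<open>B1\<close> has colours
  \<open>i\<close> and \<open>j\<close> arranged by the side \<open>A\<close>, and two paths cover
  both blocks in every combination.\<close>

lemma forked_coverable:
  assumes A: "A = A2 \<union> A3" "A2 \<inter> A3 = {}" and B: "B = B1 \<union> B'" and AB: "card A = card B"
    and c: "complete_in (E i) A2 B1" "complete_in (E j) A3 B1"
    and two: "\<And>a b. a \<in> A2 \<Longrightarrow> b \<in> B' \<Longrightarrow> E h a b \<or> E i a b"
      "\<And>a b. a \<in> A3 \<Longrightarrow> b \<in> B' \<Longrightarrow> E h a b \<or> E j a b"
    and B': "\<And>b. b \<in> B' \<Longrightarrow> complete_in (E h) A2 {b} \<or> complete_in (E h) A3 {b}"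
  shows "coverable E 3 (A \<union> B)"
proof (rule colour_split[OF subset_refl subset_refl AB, where k = h], goal_cases)
  case (1 PX X1 X2 PY Y1 Y2)
  interpret swap: bipartite_colouring E B A by (rule swap_sides)
  have sub: "X1 \<subseteq> A" "X2 \<subseteq> A" "Y1 \<subseteq> B" "Y2 \<subseteq> B"
    using 1(1,5) by auto
  have mono: "Y \<subseteq> B1 \<or> X \<subseteq> A2 \<and> complete_in (E i) X Y \<or> X \<subseteq> A3 \<and> complete_in (E j) X Y"
    if XY: "X \<subseteq> A" "Y \<subseteq> B" "\<And>x y. x \<in> X \<Longrightarrow> y \<in> Y \<Longrightarrow> \<not> E h x y" for X Y
  proof (cases "Y \<subseteq> B1")
    case False
    then obtain b where b: "b \<in> Y" "b \<in> B'" using XY(2) B by blast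
    from B'[OF b(2)] have "X \<subseteq> A2 \<or> X \<subseteq> A3"
      using b XY A(1) unfolding complete_in_def by blast
    then show ?thesis
      using XY c two B unfolding complete_in_def by blast
  qed blast
  have cX: "complete_in (E i) (X \<inter> A2) Y" "complete_in (E j) (X \<inter> A3) Y" if "Y \<subseteq> B1" for X Y
    using c that by (auto simp: complete_in_def)
  have fork: "coverable E 2 (X \<union> Y \<union> (X' \<union> Y'))"
    if XY: "X \<subseteq> A" "Y \<subseteq> B" "card X = card Y" "X' \<subseteq> A" "Y' \<subseteq> B" "card X' = card Y'"
      "X \<inter> X' = {}" "Y \<inter> Y' = {}" "Y \<subseteq> B1"
      and X': "X' \<subseteq> A2 \<and> complete_in (E i) X' Y' \<or> X' \<subseteq> A3 \<and> complete_in (E j) X' Y'"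
    for X Y X' Y'
    using X'
  proof
    assume "X' \<subseteq> A2 \<and> complete_in (E i) X' Y'"
    then have "complete_in (E i) X' (Y \<union> Y')" using c XY(9) unfolding complete_in_def by blast
    then show ?thesis
      by (intro merged_coverable[OF XY(1-8) _ _ cX(1,2)[OF XY(9), of X]])
        (use A XY(1) in auto)
  next
    assume "X' \<subseteq> A3 \<and> complete_in (E j) X' Y'"
    then have "complete_in (E j) X' (Y \<union> Y')" using c XY(9) unfolding complete_in_def by blast
    then show ?thesis
      by (intro merged_coverable[OF XY(1-8) _ _ cX(2,1)[OF XY(9), of X]])
        (use A XY(1) in auto)
  qed
  have cov2: "coverable E 2 (X1 \<union> Y1 \<union> (X2 \<union> Y2))"
  proof (cases "Y1 \<subseteq> B1"; cases "Y2 \<subseteq> B1")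
    \<comment> \<open>Covering the two blocks separately could take four paths, so they are pooled
      and \<open>?Y\<close> is redistributed between the parts of \<open>?X\<close> in
      \<open>A2\<close> and in \<open>A3\<close>.\<close>
    assume b: "Y1 \<subseteq> B1" "Y2 \<subseteq> B1"
    let ?X = "X1 \<union> X2" and ?Y = "Y1 \<union> Y2"
    have fin: "finite X1" "finite X2" "finite Y1" "finite Y2"
      using sub finite_A finite_B by (auto intro: finite_subset)
    have "card ?Y = card ?X" using 1(4,8-10) fin by (simp add: card_Un_disjoint)
    also have "\<dots> = card (?X \<inter> A2 \<union> ?X \<inter> A3)"
      using A(1) sub by (intro arg_cong[of _ _ card]) auto
    also have "\<dots> = card (?X \<inter> A2) + card (?X \<inter> A3)"
      using A(2) fin by (intro card_Un_disjoint) auto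
    finally have "card ?Y = card (?X \<inter> A2) + card (?X \<inter> A3)" .
    then have "coverable E 2 (?Y \<union> (?X \<inter> A2 \<union> ?X \<inter> A3))"
      by (rule swap.split_coverable[rotated 4, where i = i and j = j])
        (use sub A cX[where Y = ?Y and X = ?X] b complete_in_commute in auto)
    moreover have "?Y \<union> (?X \<inter> A2 \<union> ?X \<inter> A3) = X1 \<union> Y1 \<union> (X2 \<union> Y2)"
      using A(1) sub by blast
    ultimately show ?thesis by simp
  next
    assume "Y1 \<subseteq> B1" "\<not> Y2 \<subseteq> B1"
    then show ?thesis
      using fork[of X1 Y1 X2 Y2] mono[OF sub(2,4) 1(15)] 1 sub by blast
  next
    assume "\<not> Y1 \<subseteq> B1" "Y2 \<subseteq> B1"
    then have "coverable E 2 (X2 \<union> Y2 \<union> (X1 \<union> Y1))"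
      using mono[OF sub(1,3) 1(14)] 1 sub by (intro fork) auto
    then show ?thesis by (simp add: Un_commute)
  next
    assume "\<not> Y1 \<subseteq> B1" "\<not> Y2 \<subseteq> B1"
    then have "coverable E 1 (X1 \<union> Y1)" "coverable E 1 (X2 \<union> Y2)"
      using mono[OF sub(1,3) 1(14)] mono[OF sub(2,4) 1(15)] complete_coverable
        sub 1(9,10) by blast+
    then show ?thesis
      by (rule coverable_1_1) (use 1(1-8) disjoint_AB in blast)+
  qed
  show ?case
    by (rule coverable_1_2[OF 1(16) cov2]) (use 1(1-8) disjoint_AB in blast)+
qed

text \<open>One path absorbs all of \<open>Aq\<close>. Whatever part of \<open>B\<close> it uses,
  the remaining vertices of \<open>B\<close> are still sorted by their colour to \<open>Ap\<close>,
  so two more paths suffice.\<close>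

lemma split_side_coverable_aux:
  assumes "A = Ap \<union> Aq" "Ap \<inter> Aq = {}" "B = B1 \<union> B2" "B1 \<inter> B2 = {}" "card A = card B"
    and "complete_in (E i) Ap B1" "complete_in (E j) Ap B2"
    and "C \<subseteq> B" "complete_in (E k) Aq C" "card Aq \<le> card C"
  shows "coverable E 3 (A \<union> B)"
proof -
  have fin: "finite A" "finite B" "finite Ap" "finite Aq"
    using finite_A finite_B assms(1) by auto
  obtain Y where Y: "Y \<subseteq> C" "card Y = card Aq" "finite Y"
    using assms(10) by (rule obtain_subset_with_card_n)
  have c1: "coverable E 1 (Aq \<union> Y)"
    using Y assms by (intro complete_coverable[where k = k]) (auto simp: complete_in_def)
  have "card (B - Y) = card (B1 - Y) + card (B2 - Y)"
    using assms(3,4) fin by (subst card_Un_disjoint[symmetric]) (auto intro!: arg_cong[of _ _ card])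
  moreover have "card (B - Y) = card A - card Aq"
    using Y assms(5,8) by (metis card_Diff_subset order_trans)
  moreover have "card A = card Ap + card Aq"
    using assms(1,2) fin by (simp add: card_Un_disjoint)
  ultimately have "card Ap = card (B1 - Y) + card (B2 - Y)" by simp
  then have c2: "coverable E 2 (Ap \<union> ((B1 - Y) \<union> (B2 - Y)))"
    by (rule split_coverable[rotated 4, where i = i and j = j])
      (use assms in \<open>auto simp: complete_in_def\<close>)
  have "(Aq \<union> Y) \<inter> (Ap \<union> ((B1 - Y) \<union> (B2 - Y))) = {}"
    using assms(1-4,8) Y(1) disjoint_AB by blast
  then show ?thesis
    by (rule coverable_1_2[OF c1 c2]) (use assms(1-4,8) Y(1) in auto)
qed

text \<open>If \<open>Aq\<close> were larger than both \<open>B3\<close> and \<open>B4\<close>, it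
  would exceed half of \<open>A\<close>; likewise for \<open>Ap\<close> with \<open>B1\<close> and
  \<open>B2\<close>. Both cannot happen, so one class fits into a part facing it.\<close>

lemma split_side_coverable:
  assumes A: "A = Ap \<union> Aq" "Ap \<inter> Aq = {}" and AB: "card A = card B"
    and B: "B = B1 \<union> B2" "B1 \<inter> B2 = {}" "B = B3 \<union> B4" "B3 \<inter> B4 = {}"
    and c: "complete_in (E i) Ap B1" "complete_in (E j) Ap B2"
      "complete_in (E k) Aq B3" "complete_in (E l) Aq B4"
  shows "coverable E 3 (A \<union> B)"
proof -
  have fin: "finite B1" "finite B2" "finite B3" "finite B4" "finite Ap" "finite Aq"
    using finite_A finite_B A B by (metis finite_Un)+
  have "card Ap + card Aq = card B1 + card B2" "card Ap + card Aq = card B3 + card B4"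
    using A B AB fin by (metis card_Un_disjoint)+
  then consider "card Aq \<le> card B3" | "card Aq \<le> card B4" | "card Ap \<le> card B1" | "card Ap \<le> card B2"
    by linarith
  then show ?thesis
  proof cases
    case 1
    show ?thesis
      by (rule split_side_coverable_aux[OF A B(1,2) AB c(1,2) _ c(3) 1]) (use B in auto)
  next
    case 2
    show ?thesis
      by (rule split_side_coverable_aux[OF A B(1,2) AB c(1,2) _ c(4) 2]) (use B in auto)
  next
    case 3
    show ?thesis
      by (rule split_side_coverable_aux[OF _ _ B(3,4) AB c(3,4) _ c(1) 3]) (use A B in auto)
  next
    case 4
    show ?thesis
      by (rule split_side_coverable_aux[OF _ _ B(3,4) AB c(3,4) _ c(2) 4]) (use A B in auto)
  qed
qed

end

section \<open>Blocks with forced colours\<close>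

lemma obtain_split:
  assumes "finite S" "card S = m + n"
  obtains U V where "S = U \<union> V" "U \<inter> V = {}" "card U = m" "card V = n"
proof -
  have "m \<le> card S" using assms by simp
  then obtain U where U: "U \<subseteq> S" "card U = m" "finite U" by (rule obtain_subset_with_card_n)
  show thesis
    by (rule that[of U "S - U"]) (use U assms in \<open>auto simp: card_Diff_subset\<close>)
qed

lemma obtain_subset_containing:
  assumes "finite S" "x \<in> S" "0 < n" "n \<le> card S"
  obtains T where "T \<subseteq> S" "x \<in> T" "card T = n"
proof -
  have "n - 1 \<le> card (S - {x})" using assms by simp
  then obtain T where T: "T \<subseteq> S - {x}" "card T = n - 1" "finite T"
    by (rule obtain_subset_with_card_n)
  then have "card (insert x T) = n"
    using assms(3) by (subst card_insert_disjoint) auto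
  then show thesis
    using T assms(2) by (intro that[of "insert x T"]) auto
qed

text \<open>A 3 by 3 transportation problem with zero diagonal: \<open>xij\<close> vertices of class
  \<open>i\<close> on one side will be matched with class \<open>j\<close> on the other. The
  inequalities say that class \<open>i\<close> on either side fits into the two other classes
  opposite.\<close>

lemma transport_numbers:
  fixes a1 a2 a3 b1 b2 b3 :: nat
  assumes "a1 + a2 + a3 = b1 + b2 + b3"
    and "a1 + b1 \<le> a1 + a2 + a3" "a2 + b2 \<le> a1 + a2 + a3" "a3 + b3 \<le> a1 + a2 + a3"
  obtains x12 x13 x21 x23 x31 x32 where
    "a1 = x12 + x13" "a2 = x21 + x23" "a3 = x31 + x32"
    "b1 = x21 + x31" "b2 = x12 + x32" "b3 = x13 + x23"
proof -
  \<comment> \<open>One degree of freedom remains, \<open>t = x12\<close>, which determines the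
    other entries. This is its least admissible value; truncated subtraction supplies the bound
    \<open>t \<ge> 0\<close>.\<close>
  define t where "t = max (b2 - a3) (a1 - b3)"
  have "t \<le> a1" "t \<le> b2" "t + a3 \<le> b1 + b2" "b2 \<le> t + a3" "a1 \<le> t + b3"
    using assms unfolding t_def by linarith+
  then show thesis
    using assms(1)
    by (intro that[of t "a1 - t" "b1 + b2 - (a3 + t)" "b3 + t - a1" "a3 + t - b2" "b2 - t"]) linarith+
qed

context bipartite_colouring
begin

text \<open>\<open>Ap\<close> is large enough to serve all of \<open>Bs\<close> in colour
  \<open>i\<close>, and then \<open>Bq\<close> is large enough to serve \<open>Ar\<close> in colour
  \<open>l\<close>. The leftovers of \<open>Ap\<close> and \<open>Bq\<close> balance and see each
  other in colour \<open>s\<close>.\<close>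

lemma big_block_coverable:
  assumes A: "A = Ap \<union> Ar" "Ap \<inter> Ar = {}" and B: "B = Bq \<union> Bs" "Bq \<inter> Bs = {}"
    and AB: "card A = card B"
    and c: "complete_in (E i) Ap Bs" "complete_in (E l) Ar Bq" "complete_in (E s) Ap Bq"
    and le: "card Bs \<le> card Ap"
  shows "coverable E 3 (A \<union> B)"
proof -
  have fin: "finite Ap" "finite Ar" "finite Bq" "finite Bs"
    using finite_A finite_B A B by auto
  have n: "card Ap + card Ar = card Bq + card Bs"
    using A B AB fin by (simp add: card_Un_disjoint)
  obtain W where W: "W \<subseteq> Ap" "card W = card Bs" "finite W"
    using le by (rule obtain_subset_with_card_n)
  have "card Ar \<le> card Bq" using n le by simp
  then obtain V where V: "V \<subseteq> Bq" "card V = card Ar" "finite V"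
    by (rule obtain_subset_with_card_n)
  have sub: "Ap \<subseteq> A" "Ar \<subseteq> A" "Bq \<subseteq> B" "Bs \<subseteq> B" using A B by auto
  have c1: "coverable E 1 (W \<union> Bs)"
    using W c sub by (intro complete_coverable[where k = i]) (auto simp: complete_in_def)
  have c2: "coverable E 1 (Ar \<union> V)"
    using V c sub by (intro complete_coverable[where k = l]) (auto simp: complete_in_def)
  have c3: "coverable E 1 ((Ap - W) \<union> (Bq - V))"
    using W V c sub n by (intro complete_coverable[where k = s])
      (auto simp: complete_in_def card_Diff_subset)
  show ?thesis
    by (rule coverable_1_1_1[OF c1 c2 c3]) (use A B W(1) V(1) disjoint_AB in blast)+
qed

text \<open>Filling \<open>Ap\<close> up from \<open>Af\<close> to the size of \<open>Bp\<close>
  gives one \<open>i\<close>-path. It uses up \<open>Ap\<close> and \<open>Bp\<close>, so the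
  remainder has only the colours \<open>i\<close> and \<open>l\<close>, and there a vertex of
  \<open>Aq\<close> or \<open>Bq\<close> has only \<open>l\<close>-edges; such a vertex brings the
  cost down to two. If there is none, the whole graph has two colours.\<close>

lemma threaded_coverable_aux:
  assumes A: "A = Ap \<union> Af \<union> Aq" "Ap \<inter> Af = {}" "Ap \<inter> Aq = {}" "Af \<inter> Aq = {}"
    and B: "B = Bp \<union> Bf \<union> Bq" "Bp \<inter> Bf = {}" "Bp \<inter> Bq = {}" "Bf \<inter> Bq = {}"
    and AB: "card A = card B" and il: "i \<noteq> l"
    and c: "complete_in (E i) (Ap \<union> Af) Bp" "complete_in (E i) Ap Bf"
      "complete_in (E l) (Af \<union> Aq) Bq" "complete_in (E l) Aq Bf"
    and f: "\<And>x y. x \<in> Af \<Longrightarrow> y \<in> Bf \<Longrightarrow> E i x y \<or> E l x y"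
    and le: "card Ap \<le> card Bp" "card Bp \<le> card Ap + card Af"
  shows "coverable E 3 (A \<union> B)"
proof (cases "Aq = {} \<and> Bq = {}")
  case True
  show ?thesis
  proof (rule two_colours_coverable[OF subset_refl subset_refl AB])
    show "E i x y \<or> E l x y" if "x \<in> A" "y \<in> B" for x y
      using that True c f unfolding A(1) B(1) complete_in_def by blast
  qed
next
  case False
  have fin: "finite Ap" "finite Af" "finite Aq" "finite Bp" "finite Bf" "finite Bq"
    using finite_A finite_B A(1) B(1) by auto
  have "card A = card Ap + card Af + card Aq" "card B = card Bp + card Bf + card Bq"
    unfolding A(1) B(1) using A(2-4) B(2-4) fin
    by (simp_all add: card_Un_disjoint Int_Un_distrib2)
  then have n: "card Ap + card Af + card Aq = card Bp + card Bf + card Bq"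
    using AB by simp
  have "card Bp - card Ap \<le> card Af" using le by simp
  then obtain X where X: "X \<subseteq> Af" "card X = card Bp - card Ap" "finite X"
    by (rule obtain_subset_with_card_n)
  have sub: "Ap \<subseteq> A" "Af \<subseteq> A" "Aq \<subseteq> A" "Bp \<subseteq> B" "Bf \<subseteq> B" "Bq \<subseteq> B" using A B by auto
  have "card (Ap \<union> X) = card Ap + card X"
    using A X fin by (intro card_Un_disjoint) auto
  then have c1: "coverable E 1 ((Ap \<union> X) \<union> Bp)"
    using X c sub le by (intro complete_coverable[where k = i]) (auto simp: complete_in_def)
  let ?X = "(Af - X) \<union> Aq" and ?Y = "Bf \<union> Bq"
  have "card ?X = card (Af - X) + card Aq"
    using A fin by (intro card_Un_disjoint) auto
  also have "\<dots> = card Bf + card Bq"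
    using X n le card_mono[OF fin(2) X(1)] by (simp add: card_Diff_subset)
  also have "\<dots> = card ?Y"
    using B fin by (simp add: card_Un_disjoint)
  finally have cXY: "card ?X = card ?Y" .
  have sXY: "?X \<subseteq> A" "?Y \<subseteq> B" using sub by auto
  have two: "E i x y \<or> E l x y" if "x \<in> ?X" "y \<in> ?Y" for x y
    using that c f unfolding complete_in_def by blast
  have c2: "coverable E 2 (?X \<union> ?Y)"
  proof (cases "Aq = {}")
    case True
    then obtain z where z: "z \<in> Bq" using False by blast
    then have "\<not> E i x z" if "x \<in> ?X" for x
      using c that E_unique il by (auto simp: complete_in_def)
    then show ?thesis
      using two_colours_pure_right[OF sXY cXY two, of z] z by blast
  next
    case False
    then obtain z where z: "z \<in> Aq" by blast
    then have "\<not> E i z y" if "y \<in> ?Y" for y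
      using c that E_unique il by (auto simp: complete_in_def)
    then show ?thesis
      using two_colours_pure_left[OF sXY cXY two, of z] z by blast
  qed
  show ?thesis
  proof (rule coverable_1_2[OF c1 c2])
    show "(Ap \<union> X \<union> Bp) \<inter> (?X \<union> ?Y) = {}"
      using A(2-4) B(2-4) X(1) sub disjoint_AB by blast
    show "A \<union> B = Ap \<union> X \<union> Bp \<union> (?X \<union> ?Y)"
      using A(1) B(1) X(1) by blast
  qed
qed

text \<open>Either \<open>Ap\<close> and \<open>Bp\<close> differ by no more than \<open>Af\<close>
  or \<open>Bf\<close> can compensate, or one of \<open>Ap\<close>, \<open>Aq\<close> dominates. The
  colours \<open>s\<close> and \<open>t\<close> serve the leftovers of a dominating block.\<close>

lemma threaded_coverable:
  assumes A: "A = Ap \<union> Af \<union> Aq" "Ap \<inter> Af = {}" "Ap \<inter> Aq = {}" "Af \<inter> Aq = {}"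
    and B: "B = Bp \<union> Bf \<union> Bq" "Bp \<inter> Bf = {}" "Bp \<inter> Bq = {}" "Bf \<inter> Bq = {}"
    and AB: "card A = card B" and il: "i \<noteq> l"
    and c: "complete_in (E i) (Ap \<union> Af) Bp" "complete_in (E i) Ap Bf"
      "complete_in (E l) (Af \<union> Aq) Bq" "complete_in (E l) Aq Bf"
    and f: "\<And>x y. x \<in> Af \<Longrightarrow> y \<in> Bf \<Longrightarrow> E i x y \<or> E l x y"
    and st: "complete_in (E s) Ap Bq" "complete_in (E t) Aq Bp"
  shows "coverable E 3 (A \<union> B)"
proof -
  interpret swap: bipartite_colouring E B A by (rule swap_sides)
  have fin: "finite Ap" "finite Af" "finite Aq" "finite Bp" "finite Bf" "finite Bq"
    using finite_A finite_B A(1) B(1) by auto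
  have cA: "card A = card Ap + card Af + card Aq" and cB: "card B = card Bp + card Bf + card Bq"
    unfolding A(1) B(1) using A(2-4) B(2-4) fin
    by (simp_all add: card_Un_disjoint Int_Un_distrib2)
  consider "card Bp + card Bf \<le> card Ap" | "card Bq + card Bf \<le> card Aq"
    | "card Ap \<le> card Bp" "card Bp \<le> card Ap + card Af"
    | "card Bp \<le> card Ap" "card Ap \<le> card Bp + card Bf"
    using cA cB AB by linarith
  then show ?thesis
  proof cases
    case 1
    show ?thesis
    proof (rule big_block_coverable[OF _ _ _ _ AB _ c(3) st(1)])
      show "A = Ap \<union> (Af \<union> Aq)" "B = Bq \<union> (Bp \<union> Bf)" using A B by auto
      show "Ap \<inter> (Af \<union> Aq) = {}" "Bq \<inter> (Bp \<union> Bf) = {}" using A B by auto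
      show "card (Bp \<union> Bf) \<le> card Ap" using 1 B fin by (simp add: card_Un_disjoint)
      show "complete_in (E i) Ap (Bp \<union> Bf)" using c by (auto simp: complete_in_def)
    qed
  next
    case 2
    show ?thesis
    proof (rule big_block_coverable[OF _ _ _ _ AB _ c(1) st(2)])
      show "A = Aq \<union> (Ap \<union> Af)" "B = Bp \<union> (Bq \<union> Bf)" using A B by auto
      show "Aq \<inter> (Ap \<union> Af) = {}" "Bp \<inter> (Bq \<union> Bf) = {}" using A B by auto
      show "card (Bq \<union> Bf) \<le> card Aq" using 2 B fin by (simp add: card_Un_disjoint Int_commute)
      show "complete_in (E l) Aq (Bq \<union> Bf)" using c by (auto simp: complete_in_def)
    qed
  next
    case 3
    show ?thesis
      by (rule threaded_coverable_aux[OF A B AB il c _ 3]) (rule f)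
  next
    case 4
    have c': "complete_in (E i) (Bp \<union> Bf) Ap" "complete_in (E i) Bp Af"
      "complete_in (E l) (Bf \<union> Bq) Aq" "complete_in (E l) Bq Af"
      using c unfolding complete_in_Un by (simp_all only: complete_in_commute[of _ _ Ap]
          complete_in_commute[of _ _ Af] complete_in_commute[of _ _ Aq])
    have "coverable E 3 (B \<union> A)"
      by (rule swap.threaded_coverable_aux[OF B A AB[symmetric] il c' _ 4])
        (meson f E_sym)
    then show ?thesis by (simp add: Un_commute)
  qed
qed

section \<open>Three colours: the triangular configuration\<close>

text \<open>
  The vertices in \<open>Ai\<close> and \<open>Bi\<close> are those whose palette is \<open>{k1, k2, k3} - {ki}\<close>.
\<close>

definition triangular :: "'c \<Rightarrow> 'c \<Rightarrow> 'c \<Rightarrow> 'a set \<Rightarrow> 'a set \<Rightarrow> 'a set \<Rightarrow> 'a set \<Rightarrow> 'a set \<Rightarrow> 'a set \<Rightarrow> bool" where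
  "triangular k1 k2 k3 A1 A2 A3 B1 B2 B3 \<longleftrightarrow>
     distinct [k1, k2, k3] \<and>
     A = A1 \<union> A2 \<union> A3 \<and> A1 \<inter> A2 = {} \<and> A1 \<inter> A3 = {} \<and> A2 \<inter> A3 = {} \<and>
     B = B1 \<union> B2 \<union> B3 \<and> B1 \<inter> B2 = {} \<and> B1 \<inter> B3 = {} \<and> B2 \<inter> B3 = {} \<and>
     complete_in (E k3) A1 B2 \<and> complete_in (E k3) A2 B1 \<and>
     complete_in (E k2) A1 B3 \<and> complete_in (E k2) A3 B1 \<and>
     complete_in (E k1) A2 B3 \<and> complete_in (E k1) A3 B2 \<and>
     (\<forall>x \<in> A1. \<forall>y \<in> B1. E k2 x y \<or> E k3 x y) \<and>
     (\<forall>x \<in> A2. \<forall>y \<in> B2. E k3 x y \<or> E k1 x y) \<and>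
     (\<forall>x \<in> A3. \<forall>y \<in> B3. E k1 x y \<or> E k2 x y)"

text \<open>With \<open>triangular_transpose\<close> this generates all permutations of the three
  indices, so later cases need only be treated up to relabelling.\<close>

lemma triangular_rotate:
  "triangular k1 k2 k3 A1 A2 A3 B1 B2 B3 \<Longrightarrow> triangular k2 k3 k1 A2 A3 A1 B2 B3 B1"
  unfolding triangular_def by (auto simp: Un_ac Int_commute)

lemma triangular_transpose:
  "triangular k1 k2 k3 A1 A2 A3 B1 B2 B3 \<Longrightarrow> triangular k1 k3 k2 A1 A3 A2 B1 B3 B2"
  unfolding triangular_def by (auto simp: Un_ac Int_commute)

lemma triangular_swap_sides:
  assumes "triangular k1 k2 k3 A1 A2 A3 B1 B2 B3"
  shows "bipartite_colouring.triangular E B A k1 k2 k3 B1 B2 B3 A1 A2 A3"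
proof -
  interpret swap: bipartite_colouring E B A by (rule swap_sides)
  have two: "(\<forall>x \<in> S. \<forall>y \<in> T. E i x y \<or> E j x y) \<longleftrightarrow> (\<forall>y \<in> T. \<forall>x \<in> S. E i y x \<or> E j y x)"
    for i j S T
    using E_sym by meson
  show ?thesis
    using assms unfolding triangular_def swap.triangular_def
    by (simp add: two[of B1] two[of B2] two[of B3] complete_in_commute[of _ B1]
        complete_in_commute[of _ B2] complete_in_commute[of _ B3])
qed

lemma triangular_card:
  assumes "triangular k1 k2 k3 A1 A2 A3 B1 B2 B3"
  shows "finite A1" "finite A2" "finite A3" "finite B1" "finite B2" "finite B3"
    and "card A = card A1 + card A2 + card A3" "card B = card B1 + card B2 + card B3"
proof -
  have AB: "A = A1 \<union> A2 \<union> A3" "B = B1 \<union> B2 \<union> B3"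
    "A1 \<inter> A2 = {}" "A1 \<inter> A3 = {}" "A2 \<inter> A3 = {}" "B1 \<inter> B2 = {}" "B1 \<inter> B3 = {}" "B2 \<inter> B3 = {}"
    using assms unfolding triangular_def by auto
  show fin: "finite A1" "finite A2" "finite A3" "finite B1" "finite B2" "finite B3"
    using finite_A finite_B AB(1,2) by auto
  show "card A = card A1 + card A2 + card A3" "card B = card B1 + card B2 + card B3"
    unfolding AB(1,2) using AB(3-) fin by (simp_all add: card_Un_disjoint Int_Un_distrib2)
qed

text \<open>All edges between \<open>A1 \<union> A2\<close> and \<open>B1 \<union> B2\<close> have
  colour \<open>k3\<close>, which costs one path. Covering \<open>A3\<close> and \<open>B3\<close>
  with two paths needs a helper vertex borrowed from this block: seen from outside, each of its
  vertices has a single colour to \<open>A3\<close> or \<open>B3\<close>.\<close>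

lemma triangular_two_equal_coverable_aux:
  assumes tri: "triangular k1 k2 k3 A1 A2 A3 B1 B2 B3" and AB: "card A = card B"
    and c: "complete_in (E k3) A1 B1" "complete_in (E k3) A2 B2"
    and le: "card A3 \<le> card B3"
  shows "coverable E 3 (A \<union> B)"
proof -
  note fin = triangular_card[OF tri]
  have dA: "A = A1 \<union> A2 \<union> A3" "A1 \<inter> A3 = {}" "A2 \<inter> A3 = {}"
    and dB: "B = B1 \<union> B2 \<union> B3" "B1 \<inter> B3 = {}" "B2 \<inter> B3 = {}"
    and k: "k1 \<noteq> k2"
    and c3: "complete_in (E k3) (A1 \<union> A2) (B1 \<union> B2)"
    and e2: "complete_in (E k2) A1 B3" "complete_in (E k2) A3 B1"
    and e1: "complete_in (E k1) A2 B3" "complete_in (E k1) A3 B2"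
    and two: "\<And>x y. x \<in> A3 \<Longrightarrow> y \<in> B3 \<Longrightarrow> E k1 x y \<or> E k2 x y"
    using tri c unfolding triangular_def complete_in_Un by auto
  have sub: "A1 \<union> A2 \<subseteq> A" "A3 \<subseteq> A" "B1 \<union> B2 \<subseteq> B" "B3 \<subseteq> B" using dA dB by auto
  have fU: "finite (A1 \<union> A2)" "finite (B1 \<union> B2)" using fin by auto
  have "card (A1 \<union> A2) + card A3 = card A" "card (B1 \<union> B2) + card B3 = card B"
    unfolding dA(1) dB(1) using dA dB fin by (simp_all add: card_Un_disjoint Int_Un_distrib2)
  then have n: "card (A1 \<union> A2) + card A3 = card (B1 \<union> B2) + card B3" using AB by simp
  show ?thesis
  proof (cases "card A3 = card B3")
    case eq: True
    then have eq': "card (A1 \<union> A2) = card (B1 \<union> B2)" using n by simp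
    show ?thesis
    proof (cases "B1 \<union> B2 = {}")
      case True
      then have "A1 \<union> A2 = {}" using eq' fU by (metis card_0_eq card.empty)
      then have "A = A3" "B = B3" using True dA(1) dB(1) by auto
      then show ?thesis
        using two_colours_coverable[OF subset_refl subset_refl AB] two by blast
    next
      case False
      \<comment> \<open>Moving \<open>y\<close> makes the \<open>k3\<close>-block odd, which still
        has a Hamiltonian path, and \<open>y\<close> joins the two leftover blocks between
        \<open>A3\<close> and \<open>B3\<close>.\<close>
      then obtain y where y: "y \<in> B1 \<union> B2" by blast
      have yB: "y \<in> B" "y \<notin> B3" using y dB by auto
      have c2: "coverable E 2 (A3 \<union> insert y B3)"
      proof (cases "y \<in> B1")
        case True
        then have "complete_in (E k2) A3 {y}" using e2 by (auto simp: complete_in_def)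
        then show ?thesis
          using two_colours_extra[OF sub(2,4) eq _ yB] two by blast
      next
        case False
        then have "complete_in (E k1) A3 {y}" using e1 y by (auto simp: complete_in_def)
        then show ?thesis
          using two_colours_extra[OF sub(2,4) eq _ yB] two by blast
      qed
      have c: "card (A1 \<union> A2) = card (B1 \<union> B2 - {y}) + 1"
        using eq' y fU by (metis Suc_eq_plus1 card.remove)
      obtain x where x: "x \<in> A1 \<union> A2"
        using eq' False fU by (metis card_0_eq card.empty all_not_in_conv)
      have c3': "complete_in (E k3) (A1 \<union> A2) (B1 \<union> B2 - {y})"
        using c3 by (rule complete_in_mono) auto
      have "B1 \<union> B2 - {y} \<subseteq> B" using sub(3) by blast
      then obtain v where "ham_path E k3 x ((A1 \<union> A2) \<union> (B1 \<union> B2 - {y})) v"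
        using complete_ham_path_odd[OF sub(1) _ c c3' x] by blast
      then have "coverable E 1 ((A1 \<union> A2) \<union> (B1 \<union> B2 - {y}))"
        by (rule coverable_ham_path)
      then show ?thesis
      proof (rule coverable_1_2[OF _ c2])
        show "((A1 \<union> A2) \<union> (B1 \<union> B2 - {y})) \<inter> (A3 \<union> insert y B3) = {}"
          using dA(2,3) dB(2,3) y sub disjoint_AB by blast
        show "A \<union> B = ((A1 \<union> A2) \<union> (B1 \<union> B2 - {y})) \<union> (A3 \<union> insert y B3)"
          using dA(1) dB(1) y by blast
      qed
    qed
  next
    case False
    \<comment> \<open>The deficit of \<open>A3\<close> is filled from the \<open>k3\<close>-block,
      and any \<open>z\<close> among the fillers is the vertex lacking one colour to
      \<open>B3\<close>.\<close>
    have "card B3 - card A3 \<le> card (A1 \<union> A2)" using n by simp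
    then obtain Z where Z: "Z \<subseteq> A1 \<union> A2" "card Z = card B3 - card A3" "finite Z"
      by (rule obtain_subset_with_card_n)
    have "card Z \<noteq> 0" using Z False le by simp
    then obtain z where z: "z \<in> Z" by fastforce
    have "card (A3 \<union> Z) = card A3 + card Z"
      using Z dA fin by (intro card_Un_disjoint) auto
    then have cZ: "card (A3 \<union> Z) = card B3" using Z le by simp
    have sZ: "A3 \<union> Z \<subseteq> A" using sub Z(1) by blast
    have two1: "E k1 x y \<or> E k2 x y" if "x \<in> A3 \<union> Z" "y \<in> B3" for x y
      using that two e1(1) e2(1) Z(1) unfolding complete_in_def by blast
    have two2: "E k2 x y \<or> E k1 x y" if "x \<in> A3 \<union> Z" "y \<in> B3" for x y
      using two1[OF that] by blast
    have c2: "coverable E 2 ((A3 \<union> Z) \<union> B3)"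
    proof (cases "z \<in> A1")
      case True
      then have "\<not> E k1 z y" if "y \<in> B3" for y
        using e2(1) that k E_unique[of k1 z y k2] by (auto simp: complete_in_def)
      then show ?thesis
        using two_colours_pure_left[OF sZ sub(4) cZ two1, of z] z by blast
    next
      case False
      then have "z \<in> A2" using z Z by blast
      then have "\<not> E k2 z y" if "y \<in> B3" for y
        using e1(1) that k E_unique[of k1 z y k2] by (auto simp: complete_in_def)
      then show ?thesis
        using two_colours_pure_left[OF sZ sub(4) cZ two2, of z] z by blast
    qed
    have "card (A1 \<union> A2 - Z) = card (B1 \<union> B2)"
      using Z n le by (simp add: card_Diff_subset)
    moreover have "complete_in (E k3) (A1 \<union> A2 - Z) (B1 \<union> B2)"
      using c3 by (rule complete_in_mono) auto
    ultimately have "coverable E 1 ((A1 \<union> A2 - Z) \<union> (B1 \<union> B2))"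
      using complete_coverable sub by (metis Diff_subset order_trans)
    then show ?thesis
    proof (rule coverable_1_2[OF _ c2])
      show "((A1 \<union> A2 - Z) \<union> (B1 \<union> B2)) \<inter> ((A3 \<union> Z) \<union> B3) = {}"
        using dA(2,3) dB(2,3) Z(1) sub disjoint_AB by blast
      show "A \<union> B = ((A1 \<union> A2 - Z) \<union> (B1 \<union> B2)) \<union> ((A3 \<union> Z) \<union> B3)"
        using dA(1) dB(1) Z(1) by blast
    qed
  qed
qed

lemma triangular_two_equal_coverable:
  assumes tri: "triangular k1 k2 k3 A1 A2 A3 B1 B2 B3" and AB: "card A = card B"
    and c: "complete_in (E k3) A1 B1" "complete_in (E k3) A2 B2"
  shows "coverable E 3 (A \<union> B)"
proof (cases "card A3 \<le> card B3")
  case True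
  then show ?thesis by (rule triangular_two_equal_coverable_aux[OF assms])
next
  case False
  interpret swap: bipartite_colouring E B A by (rule swap_sides)
  have "coverable E 3 (B \<union> A)"
    by (rule swap.triangular_two_equal_coverable_aux[OF triangular_swap_sides[OF tri] AB[symmetric]])
      (use False c complete_in_commute in auto)
  then show ?thesis by (simp add: Un_commute)
qed

text \<open>The pair \<open>A1\<close>, \<open>B1\<close> with its free choice between
  \<open>k2\<close> and \<open>k3\<close> is the middle of the threaded pattern; \<open>k1\<close>
  occurs only between opposite ends.\<close>

lemma triangular_two_distinct_coverable:
  assumes tri: "triangular k1 k2 k3 A1 A2 A3 B1 B2 B3" and AB: "card A = card B"
    and c: "complete_in (E k2) A3 B3" "complete_in (E k3) A2 B2"
  shows "coverable E 3 (A \<union> B)"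
  by (rule threaded_coverable[where Ap = A3 and Af = A1 and Aq = A2 and Bp = B3 and Bf = B1
        and Bq = B2 and i = k2 and l = k3 and s = k1 and t = k1])
    (use tri AB c in \<open>auto simp: triangular_def complete_in_Un\<close>)

section \<open>The triangular configuration with linking edges\<close>

lemma disjoint_sides:
  assumes "U \<subseteq> A" "U' \<subseteq> A" "W \<subseteq> B" "W' \<subseteq> B" "U \<inter> U' = {}" "W \<inter> W' = {}"
  shows "(U \<union> W) \<inter> (U' \<union> W') = {}"
  using assms disjoint_AB by blast

text \<open>Each block receives one surplus vertex, so it has a path ending there, and the edge
  \<open>x y\<close> joins the two paths. Thus two blocks of one colour merge although no edges
  between the blocks themselves are known.\<close>

lemma linked_coverable:
  assumes x: "x \<in> A" "x \<notin> X" and y: "y \<in> B" "y \<notin> Y'" and xy: "E k x y"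
    and XY: "X \<subseteq> A" "Y \<subseteq> B" "card X = card Y" "complete_in (E k) (insert x X) Y"
    and XY': "X' \<subseteq> A" "Y' \<subseteq> B" "card X' = card Y'" "complete_in (E k) X' (insert y Y')"
    and d: "insert x X \<inter> X' = {}" "Y \<inter> insert y Y' = {}"
  shows "coverable E 1 (insert x X \<union> Y \<union> (X' \<union> insert y Y'))"
proof -
  interpret swap: bipartite_colouring E B A by (rule swap_sides)
  have fin: "finite X" "finite Y'"
    using XY XY' finite_A finite_B by (auto intro: finite_subset)
  have sub: "insert x X \<subseteq> A" "insert y Y' \<subseteq> B" using x y XY XY' by auto
  have "card (insert x X) = card Y + 1" using x fin XY by simp
  then obtain u where u: "ham_path E k x (insert x X \<union> Y) u"
    using complete_ham_path_odd[OF sub(1) XY(2) _ XY(4)] by blast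
  have "card (insert y Y') = card X' + 1" using y fin XY' by simp
  then obtain v where v: "ham_path E k y (insert y Y' \<union> X') v"
    using swap.complete_ham_path_odd[OF sub(2) XY'(1) _ iffD1[OF complete_in_commute XY'(4)]] by blast
  have "(insert x X \<union> Y) \<inter> (X' \<union> insert y Y') = {}"
    by (rule disjoint_sides[OF sub(1) XY'(1) XY(2) sub(2) d])
  then have "(insert x X \<union> Y) \<inter> (insert y Y' \<union> X') = {}"
    by (simp only: Un_commute[of X'])
  then have "ham_path E k u (insert x X \<union> Y \<union> (insert y Y' \<union> X')) v"
    by (rule ham_path_append[OF ham_path_reverse[OF u] v xy])
  then show ?thesis
    unfolding Un_commute[of X'] by (rule coverable_ham_path)
qed

text \<open>\<open>A1\<close> and \<open>B1\<close> are large enough to serve all other classes at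
  once: \<open>A3\<close>, \<open>B3\<close> in colour \<open>k2\<close> and \<open>A2\<close>,
  \<open>B2\<close> in colour \<open>k3\<close>. The rest of \<open>A1\<close> and \<open>B1\<close>
  has only these two colours and is split along \<open>k2\<close>. The link \<open>x1 y1\<close>
  joins both \<open>k2\<close>-blocks, and the split path is attached at \<open>A3\<close>. The two
  \<open>k3\<close>-remainders are attached to \<open>A2\<close> and \<open>B2\<close>
  respectively.\<close>

lemma triangular_dominant_coverable:
  assumes tri: "triangular k1 k2 k3 A1 A2 A3 B1 B2 B3" and AB: "card A = card B"
    and x1: "x1 \<in> A1" and y1: "y1 \<in> B1" and link: "E k2 x1 y1"
    and ne: "A3 \<noteq> {}" "B3 \<noteq> {}" and le: "card B2 + card B3 \<le> card A1"
  shows "coverable E 3 (A \<union> B)"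
proof -
  note fin = triangular_card[OF tri]
  have dA: "A = A1 \<union> A2 \<union> A3" "A1 \<inter> A2 = {}" "A1 \<inter> A3 = {}" "A2 \<inter> A3 = {}"
    and dB: "B = B1 \<union> B2 \<union> B3" "B1 \<inter> B2 = {}" "B1 \<inter> B3 = {}" "B2 \<inter> B3 = {}"
    and e3: "complete_in (E k3) A1 B2" "complete_in (E k3) A2 B1"
    and e2: "complete_in (E k2) A1 B3" "complete_in (E k2) A3 B1"
    and two: "\<And>x y. x \<in> A1 \<Longrightarrow> y \<in> B1 \<Longrightarrow> E k2 x y \<or> E k3 x y"
    using tri unfolding triangular_def by auto
  have sub: "A1 \<subseteq> A" "A2 \<subseteq> A" "A3 \<subseteq> A" "B1 \<subseteq> B" "B2 \<subseteq> B" "B3 \<subseteq> B" using dA dB by auto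
  \<comment> \<open>Since the sides balance, dominance of \<open>A1\<close> over \<open>B\<close>
    and of \<open>B1\<close> over \<open>A\<close> are equivalent.\<close>
  have le': "card A2 + card A3 \<le> card B1" using le fin AB by simp
  have "0 < card A3" "0 < card B3" using ne fin by (auto simp: card_gt_0_iff)
  obtain X' where X': "X' \<subseteq> A1" "x1 \<in> X'" "card X' = card B3"
    using obtain_subset_containing[OF fin(1) x1 \<open>0 < card B3\<close>] le by auto
  obtain Y' where Y': "Y' \<subseteq> B1" "y1 \<in> Y'" "card Y' = card A3"
    using obtain_subset_containing[OF fin(4) y1 \<open>0 < card A3\<close>] le' by auto
  have cD: "card (A1 - X') = card A1 - card B3" "card (B1 - Y') = card B1 - card A3"
    using X' Y' fin by (simp_all add: card_Diff_subset finite_subset)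
  have "card B2 \<le> card (A1 - X')" using cD le by simp
  then obtain X'' where X'': "X'' \<subseteq> A1 - X'" "card X'' = card B2" "finite X''"
    by (rule obtain_subset_with_card_n)
  have "card A2 \<le> card (B1 - Y')" using cD le' by simp
  then obtain Y'' where Y'': "Y'' \<subseteq> B1 - Y'" "card Y'' = card A2" "finite Y''"
    by (rule obtain_subset_with_card_n)
  define X where "X = A1 - X' - X''"
  define Y where "Y = B1 - Y' - Y''"
  have cX: "card X = card A1 - card B3 - card B2" and cY: "card Y = card B1 - card A3 - card A2"
    unfolding X_def Y_def using X'' Y'' cD by (simp_all add: card_Diff_subset)
  have cXY: "card X = card Y" using cX cY fin AB by simp
  have "X \<subseteq> A1" "Y \<subseteq> B1" unfolding X_def Y_def by auto
  then have sXY: "X \<subseteq> A" "Y \<subseteq> B" using sub by auto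
  have s': "X' \<subseteq> A" "Y' \<subseteq> B" "X'' \<subseteq> A" "Y'' \<subseteq> B" using sub X' Y' X'' Y'' by auto
  obtain PX X1 X2 PY Y1 Y2 where
    s: "X = PX \<union> X1 \<union> X2" "PX \<inter> X1 = {}" "PX \<inter> X2 = {}" "X1 \<inter> X2 = {}"
    "Y = PY \<union> Y1 \<union> Y2" "PY \<inter> Y1 = {}" "PY \<inter> Y2 = {}" "Y1 \<inter> Y2 = {}"
    "card X1 = card Y1" "card X2 = card Y2"
      "PX = {} \<and> PY = {} \<or> (\<exists>u \<in> PX. \<exists>v \<in> PY. ham_path E k2 u (PX \<union> PY) v)"
      "\<And>x. x \<in> PX \<Longrightarrow> \<exists>y \<in> PY. E k2 x y" "\<And>y. y \<in> PY \<Longrightarrow> \<exists>x \<in> PX. E k2 x y"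
      "\<And>x y. x \<in> X1 \<Longrightarrow> y \<in> Y1 \<Longrightarrow> \<not> E k2 x y" "\<And>x y. x \<in> X2 \<Longrightarrow> y \<in> Y2 \<Longrightarrow> \<not> E k2 x y"
      "coverable E 1 (PX \<union> PY)"
    by (rule colour_split[OF sXY cXY, where k = k2]) (rule that; assumption)
  note P = s(11) and no = s(14,15)
  have s1: "PX \<subseteq> A1" "X1 \<subseteq> A1" "X2 \<subseteq> A1" "PY \<subseteq> B1" "Y1 \<subseteq> B1" "Y2 \<subseteq> B1"
    using s \<open>X \<subseteq> A1\<close> \<open>Y \<subseteq> B1\<close> by auto
  have c1: "complete_in (E k3) X1 Y1" and c2: "complete_in (E k3) X2 Y2"
    using s1 no two unfolding complete_in_def by blast+

  obtain a b where a: "a \<in> A3" and b: "b \<in> B3" using ne by blast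
  have h1: "ham_path E k2 a (A3 \<union> Y') y1"
    by (rule complete_ham_path[OF sub(3) s'(2) Y'(3)[symmetric] complete_in_mono[OF e2(2)] a Y'(2)])
      (use Y'(1) in auto)
  have h2: "ham_path E k2 x1 (X' \<union> B3) b"
    by (rule complete_ham_path[OF s'(1) sub(6) X'(3) complete_in_mono[OF e2(1)] X'(2) b])
      (use X'(1) in auto)
  have "(A3 \<union> Y') \<inter> (X' \<union> B3) = {}"
    using X'(1) Y'(1) dA(3) dB(3) sub disjoint_AB by blast
  then have h: "ham_path E k2 a (A3 \<union> Y' \<union> (X' \<union> B3)) b"
    by (rule ham_path_append[OF h1 h2 E_sym[OF link]])
  have cov1: "coverable E 1 (PX \<union> PY \<union> (A3 \<union> Y' \<union> (X' \<union> B3)))"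
    using P
  proof
    assume "PX = {} \<and> PY = {}"
    then show ?thesis using coverable_ham_path[OF h] by simp
  next
    assume "\<exists>u \<in> PX. \<exists>v \<in> PY. ham_path E k2 u (PX \<union> PY) v"
    then obtain u v where uv: "u \<in> PX" "v \<in> PY" "ham_path E k2 u (PX \<union> PY) v" by blast
    have "v \<in> B1" using uv s1 by blast
    then have va: "E k2 v a" by (rule E_sym[OF complete_inD[OF e2(2) a]])
    have "PX \<subseteq> A1 - X'" "PY \<subseteq> B1 - Y'" using s(1,5) X_def Y_def by auto
    then have "(PX \<union> PY) \<inter> (A3 \<union> Y' \<union> (X' \<union> B3)) = {}"
      using X'(1) Y'(1) dA(3) dB(3) sub disjoint_AB by blast
    then show ?thesis
      by (rule coverable_ham_path[OF ham_path_append[OF uv(3) h va]])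
  qed
  have cov2: "coverable E 1 (X1 \<union> Y1 \<union> (A2 \<union> Y''))"
  proof (rule joined_coverable[OF _ _ s(9) c1 sub(2) s'(4) Y''(2)[symmetric]])
    show "complete_in (E k3) A2 Y''" using e3(2) Y''(1) by (auto simp: complete_in_def)
    show "X1 \<inter> A2 = {}" using s1 dA(2) by blast
    show "Y1 \<inter> Y'' = {}" using s(5) Y_def by blast
    assume "X1 \<noteq> {}" "A2 \<noteq> {}"
    then have "Y1 \<noteq> {}" using balanced_empty_iff[of X1 Y1] s1 sub s(9) by blast
    then obtain x y where xy: "x \<in> A2" "y \<in> Y1" using \<open>A2 \<noteq> {}\<close> by blast
    then have "E k3 y x" using s1 by (intro E_sym[OF complete_inD[OF e3(2)]]) auto
    then show "\<exists>y \<in> Y1. \<exists>x \<in> A2. E k3 y x" using xy by blast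
  qed (use s1 sub in auto)
  have cov3: "coverable E 1 (X'' \<union> B2 \<union> (X2 \<union> Y2))"
  proof (rule joined_coverable[OF s'(3) sub(5) X''(2) _ _ _ s(10) c2])
    show "complete_in (E k3) X'' B2" using e3(1) X''(1) by (auto simp: complete_in_def)
    show "X'' \<inter> X2 = {}" using s(1) X_def by blast
    show "B2 \<inter> Y2 = {}" using s1 dB(2) by blast
    assume "X'' \<noteq> {}" "X2 \<noteq> {}"
    then have "B2 \<noteq> {}" using balanced_empty_iff[of X'' B2] s' sub X'' by blast
    then obtain x y where xy: "x \<in> X2" "y \<in> B2" using \<open>X2 \<noteq> {}\<close> by blast
    then have "E k3 y x" using s1 by (intro E_sym[OF complete_inD[OF e3(1)]]) auto
    then show "\<exists>y \<in> B2. \<exists>x \<in> X2. E k3 y x" using xy by blast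
  qed (use s1 sub in auto)
  have pA: "A1 = X' \<union> X'' \<union> (PX \<union> X1 \<union> X2)" "X' \<inter> X'' = {}" "(X' \<union> X'') \<inter> (PX \<union> X1 \<union> X2) = {}"
    using s(1) X_def X' X'' by auto
  have pB: "B1 = Y' \<union> Y'' \<union> (PY \<union> Y1 \<union> Y2)" "Y' \<inter> Y'' = {}" "(Y' \<union> Y'') \<inter> (PY \<union> Y1 \<union> Y2) = {}"
    using s(5) Y_def Y' Y'' by auto
  have sA: "X' \<subseteq> A1" "X'' \<subseteq> A1" "Y' \<subseteq> B1" "Y'' \<subseteq> B1" using pA(1) pB(1) by auto
  have cov:
    "coverable E 1 ((PX \<union> A3 \<union> X') \<union> (PY \<union> Y' \<union> B3))"
    "coverable E 1 ((X1 \<union> A2) \<union> (Y1 \<union> Y''))"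
    "coverable E 1 ((X'' \<union> X2) \<union> (B2 \<union> Y2))"
    using cov1 cov2 cov3 by (simp_all only: Un_ac)
  have sU: "PX \<union> A3 \<union> X' \<subseteq> A" "X1 \<union> A2 \<subseteq> A" "X'' \<union> X2 \<subseteq> A"
    "PY \<union> Y' \<union> B3 \<subseteq> B" "Y1 \<union> Y'' \<subseteq> B" "B2 \<union> Y2 \<subseteq> B"
    using sub s' s1 by auto
  have iA: "PX \<inter> X'' = {}" "X' \<inter> X1 = {}" "X' \<inter> X2 = {}" "X1 \<inter> X'' = {}"
    using pA(3) by blast+
  have iA': "A3 \<inter> X1 = {}" "A3 \<inter> A2 = {}" "A3 \<inter> X'' = {}" "A3 \<inter> X2 = {}"
    "PX \<inter> A2 = {}" "X' \<inter> A2 = {}" "A2 \<inter> X'' = {}" "A2 \<inter> X2 = {}"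
    using dA(2-4) s1(1-3) sA(1,2) by blast+
  have iB: "PY \<inter> Y'' = {}" "Y' \<inter> Y1 = {}" "Y' \<inter> Y2 = {}" "Y'' \<inter> Y2 = {}"
    using pB(3) by blast+
  have iB': "B3 \<inter> Y1 = {}" "B3 \<inter> Y'' = {}" "B3 \<inter> Y2 = {}" "B3 \<inter> B2 = {}"
    "PY \<inter> B2 = {}" "Y' \<inter> B2 = {}" "Y1 \<inter> B2 = {}" "Y'' \<inter> B2 = {}"
    using dB(2-4) s1(4-6) sA(3,4) by blast+
  note disj = s(2-4,6-8) pA(2) pB(2) iA iA' iB iB'
  show ?thesis
  proof (rule coverable_1_1_1[OF cov])
    show "((PX \<union> A3 \<union> X') \<union> (PY \<union> Y' \<union> B3)) \<inter> ((X1 \<union> A2) \<union> (Y1 \<union> Y'')) = {}"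
    proof (rule disjoint_sides[OF sU(1,2,4,5)])
      show "(PX \<union> A3 \<union> X') \<inter> (X1 \<union> A2) = {}"
        by (simp add: Int_Un_distrib Int_Un_distrib2 disj)
      show "(PY \<union> Y' \<union> B3) \<inter> (Y1 \<union> Y'') = {}"
        by (simp add: Int_Un_distrib Int_Un_distrib2 disj)
    qed
    show "((PX \<union> A3 \<union> X') \<union> (PY \<union> Y' \<union> B3)) \<inter> ((X'' \<union> X2) \<union> (B2 \<union> Y2)) = {}"
    proof (rule disjoint_sides[OF sU(1,3,4,6)])
      show "(PX \<union> A3 \<union> X') \<inter> (X'' \<union> X2) = {}"
        by (simp add: Int_Un_distrib Int_Un_distrib2 disj)
      show "(PY \<union> Y' \<union> B3) \<inter> (B2 \<union> Y2) = {}"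
        by (simp add: Int_Un_distrib Int_Un_distrib2 disj)
    qed
    show "((X1 \<union> A2) \<union> (Y1 \<union> Y'')) \<inter> ((X'' \<union> X2) \<union> (B2 \<union> Y2)) = {}"
    proof (rule disjoint_sides[OF sU(2,3,5,6)])
      show "(X1 \<union> A2) \<inter> (X'' \<union> X2) = {}"
        by (simp add: Int_Un_distrib Int_Un_distrib2 disj)
      show "(Y1 \<union> Y'') \<inter> (B2 \<union> Y2) = {}"
        by (simp add: Int_Un_distrib Int_Un_distrib2 disj)
    qed
    show "A \<union> B = ((PX \<union> A3 \<union> X') \<union> (PY \<union> Y' \<union> B3)) \<union> ((X1 \<union> A2) \<union> (Y1 \<union> Y'')) \<union>
        ((X'' \<union> X2) \<union> (B2 \<union> Y2))"
      unfolding dA(1) dB(1) pA(1) pB(1) by blast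
  qed
qed

text \<open>With the six link ends set aside, the classes are matched by the transportation numbers,
  with no \<open>Ai\<close> matched to its own \<open>Bi\<close>. Each colour then has two blocks,
  for instance \<open>k1\<close> on \<open>A3\<close>, \<open>B2\<close> and on \<open>A2\<close>,
  \<open>B3\<close>, and the reserved \<open>k1\<close>-edge between \<open>A3\<close> and
  \<open>B3\<close> joins them: one path per colour.\<close>

lemma triangular_linked_transport_coverable:
  assumes tri: "triangular k1 k2 k3 A1 A2 A3 B1 B2 B3" and AB: "card A = card B"
    and l1: "x1 \<in> A1" "y1 \<in> B1" "E k2 x1 y1"
    and l2: "x2 \<in> A2" "y2 \<in> B2" "E k3 x2 y2"
    and l3: "x3 \<in> A3" "y3 \<in> B3" "E k1 x3 y3"
    and lt: "card A1 + card B1 < card A" "card A2 + card B2 < card A" "card A3 + card B3 < card A"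
  shows "coverable E 3 (A \<union> B)"
proof -
  note fin = triangular_card[OF tri]
  have dA: "A = A1 \<union> A2 \<union> A3" "A1 \<inter> A2 = {}" "A1 \<inter> A3 = {}" "A2 \<inter> A3 = {}"
    and dB: "B = B1 \<union> B2 \<union> B3" "B1 \<inter> B2 = {}" "B1 \<inter> B3 = {}" "B2 \<inter> B3 = {}"
    and e3: "complete_in (E k3) A1 B2" "complete_in (E k3) A2 B1"
    and e2: "complete_in (E k2) A1 B3" "complete_in (E k2) A3 B1"
    and e1: "complete_in (E k1) A2 B3" "complete_in (E k1) A3 B2"
    using tri unfolding triangular_def by auto
  have sub: "A1 \<subseteq> A" "A2 \<subseteq> A" "A3 \<subseteq> A" "B1 \<subseteq> B" "B2 \<subseteq> B" "B3 \<subseteq> B" using dA dB by auto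
  have pos: "0 < card A1" "0 < card A2" "0 < card A3" "0 < card B1" "0 < card B2" "0 < card B3"
    using l1 l2 l3 fin by (auto simp: card_gt_0_iff)
  \<comment> \<open>Reserving a link removes two vertices from \<open>Ai\<close> and
    \<open>Bi\<close> together but three from the side total, which is where the strict inequalities
    are consumed.\<close>
  have "(card A1 - 1) + (card A2 - 1) + (card A3 - 1) = (card B1 - 1) + (card B2 - 1) + (card B3 - 1)"
    "(card A1 - 1) + (card B1 - 1) \<le> (card A1 - 1) + (card A2 - 1) + (card A3 - 1)"
    "(card A2 - 1) + (card B2 - 1) \<le> (card A1 - 1) + (card A2 - 1) + (card A3 - 1)"
    "(card A3 - 1) + (card B3 - 1) \<le> (card A1 - 1) + (card A2 - 1) + (card A3 - 1)"
    using lt pos fin(7,8) AB by linarith+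
  then obtain n12 n13 n21 n23 n31 n32 where n:
    "card A1 - 1 = n12 + n13" "card A2 - 1 = n21 + n23" "card A3 - 1 = n31 + n32"
    "card B1 - 1 = n21 + n31" "card B2 - 1 = n12 + n32" "card B3 - 1 = n13 + n23"
    by (rule transport_numbers)
  obtain A12 A13 where A1: "A1 - {x1} = A12 \<union> A13" "A12 \<inter> A13 = {}" "card A12 = n12" "card A13 = n13"
    using obtain_split[of "A1 - {x1}" n12 n13] fin l1 n(1) by auto
  obtain A21 A23 where A2: "A2 - {x2} = A21 \<union> A23" "A21 \<inter> A23 = {}" "card A21 = n21" "card A23 = n23"
    using obtain_split[of "A2 - {x2}" n21 n23] fin l2 n(2) by auto
  obtain A31 A32 where A3: "A3 - {x3} = A31 \<union> A32" "A31 \<inter> A32 = {}" "card A31 = n31" "card A32 = n32"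
    using obtain_split[of "A3 - {x3}" n31 n32] fin l3 n(3) by auto
  obtain B21 B31 where B1: "B1 - {y1} = B21 \<union> B31" "B21 \<inter> B31 = {}" "card B21 = n21" "card B31 = n31"
    using obtain_split[of "B1 - {y1}" n21 n31] fin l1 n(4) by auto
  obtain B12 B32 where B2: "B2 - {y2} = B12 \<union> B32" "B12 \<inter> B32 = {}" "card B12 = n12" "card B32 = n32"
    using obtain_split[of "B2 - {y2}" n12 n32] fin l2 n(5) by auto
  obtain B13 B23 where B3: "B3 - {y3} = B13 \<union> B23" "B13 \<inter> B23 = {}" "card B13 = n13" "card B23 = n23"
    using obtain_split[of "B3 - {y3}" n13 n23] fin l3 n(6) by auto
  have sA: "insert x1 A13 \<subseteq> A1" "A12 \<subseteq> A1" "insert x2 A21 \<subseteq> A2" "A23 \<subseteq> A2"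
    "insert x3 A32 \<subseteq> A3" "A31 \<subseteq> A3"
    and nA: "x1 \<notin> A13" "x1 \<notin> A12" "x2 \<notin> A21" "x2 \<notin> A23" "x3 \<notin> A32" "x3 \<notin> A31"
    using A1(1) A2(1) A3(1) l1 l2 l3 by blast+
  have sB: "insert y1 B31 \<subseteq> B1" "B21 \<subseteq> B1" "insert y2 B12 \<subseteq> B2" "B32 \<subseteq> B2"
    "insert y3 B23 \<subseteq> B3" "B13 \<subseteq> B3"
    and nB: "y1 \<notin> B31" "y1 \<notin> B21" "y2 \<notin> B12" "y2 \<notin> B32" "y3 \<notin> B23" "y3 \<notin> B13"
    using B1(1) B2(1) B3(1) l1 l2 l3 by blast+
  have pA: "A1 = insert x1 A13 \<union> A12" "A2 = insert x2 A21 \<union> A23" "A3 = insert x3 A32 \<union> A31"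
    using A1(1) A2(1) A3(1) l1 l2 l3 by blast+
  have pB: "B1 = insert y1 B31 \<union> B21" "B2 = insert y2 B12 \<union> B32" "B3 = insert y3 B23 \<union> B13"
    using B1(1) B2(1) B3(1) l1 l2 l3 by blast+
  have disj: "U \<inter> V = {}" if "U \<subseteq> Z" "V \<subseteq> W" "Z \<inter> W = {}" for U V Z W :: "'a set"
    using that by blast
  have xA: "x1 \<in> A" "x2 \<in> A" "x3 \<in> A" "A13 \<subseteq> A" "A12 \<subseteq> A" "A21 \<subseteq> A" "A23 \<subseteq> A" "A32 \<subseteq> A" "A31 \<subseteq> A"
    using order_trans[OF sA(1) sub(1)] order_trans[OF sA(2) sub(1)] order_trans[OF sA(3) sub(2)]
      order_trans[OF sA(4) sub(2)] order_trans[OF sA(5) sub(3)] order_trans[OF sA(6) sub(3)]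
    by simp_all
  have yB: "y1 \<in> B" "y2 \<in> B" "y3 \<in> B" "B31 \<subseteq> B" "B21 \<subseteq> B" "B12 \<subseteq> B" "B32 \<subseteq> B" "B23 \<subseteq> B" "B13 \<subseteq> B"
    using order_trans[OF sB(1) sub(4)] order_trans[OF sB(2) sub(4)] order_trans[OF sB(3) sub(5)]
      order_trans[OF sB(4) sub(5)] order_trans[OF sB(5) sub(6)] order_trans[OF sB(6) sub(6)]
    by simp_all
  have c1: "coverable E 1 (insert x3 A32 \<union> B32 \<union> (A23 \<union> insert y3 B23))"
  proof (rule linked_coverable[OF xA(3) nA(5) yB(3) nB(5) l3(3) xA(8) yB(7) _ _ xA(7) yB(8)])
    show "card A32 = card B32" "card A23 = card B23" using A2 A3 B2 B3 by simp_all
    show "insert x3 A32 \<inter> A23 = {}" by (rule disj[OF sA(5,4)]) (use dA(4) in blast)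
    show "B32 \<inter> insert y3 B23 = {}" by (rule disj[OF sB(4,5) dB(4)])
    show "complete_in (E k1) (insert x3 A32) B32" using e1(2) sA(5) sB(4) by (rule complete_in_mono)
    show "complete_in (E k1) A23 (insert y3 B23)" using e1(1) sA(4) sB(5) by (rule complete_in_mono)
  qed
  have c2: "coverable E 1 (insert x1 A13 \<union> B13 \<union> (A31 \<union> insert y1 B31))"
  proof (rule linked_coverable[OF xA(1) nA(1) yB(1) nB(1) l1(3) xA(4) yB(9) _ _ xA(9) yB(4)])
    show "card A13 = card B13" "card A31 = card B31" using A1 A3 B1 B3 by simp_all
    show "insert x1 A13 \<inter> A31 = {}" by (rule disj[OF sA(1,6) dA(3)])
    show "B13 \<inter> insert y1 B31 = {}" by (rule disj[OF sB(6,1)]) (use dB(3) in blast)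
    show "complete_in (E k2) (insert x1 A13) B13" using e2(1) sA(1) sB(6) by (rule complete_in_mono)
    show "complete_in (E k2) A31 (insert y1 B31)" using e2(2) sA(6) sB(1) by (rule complete_in_mono)
  qed
  have c3: "coverable E 1 (insert x2 A21 \<union> B21 \<union> (A12 \<union> insert y2 B12))"
  proof (rule linked_coverable[OF xA(2) nA(3) yB(2) nB(3) l2(3) xA(6) yB(5) _ _ xA(5) yB(6)])
    show "card A21 = card B21" "card A12 = card B12" using A1 A2 B1 B2 by simp_all
    show "insert x2 A21 \<inter> A12 = {}" by (rule disj[OF sA(3,2)]) (use dA(2) in blast)
    show "B21 \<inter> insert y2 B12 = {}" by (rule disj[OF sB(2,3) dB(2)])
    show "complete_in (E k3) (insert x2 A21) B21" using e3(2) sA(3) sB(2) by (rule complete_in_mono)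
    show "complete_in (E k3) A12 (insert y2 B12)" using e3(1) sA(2) sB(3) by (rule complete_in_mono)
  qed
  have cov: "coverable E 1 ((insert x3 A32 \<union> A23) \<union> (B32 \<union> insert y3 B23))"
    "coverable E 1 ((insert x1 A13 \<union> A31) \<union> (B13 \<union> insert y1 B31))"
    "coverable E 1 ((insert x2 A21 \<union> A12) \<union> (B21 \<union> insert y2 B12))"
    using c1 c2 c3 by (simp_all only: Un_ac)
  have sU: "insert x3 A32 \<union> A23 \<subseteq> A" "insert x1 A13 \<union> A31 \<subseteq> A" "insert x2 A21 \<union> A12 \<subseteq> A"
    "B32 \<union> insert y3 B23 \<subseteq> B" "B13 \<union> insert y1 B31 \<subseteq> B" "B21 \<union> insert y2 B12 \<subseteq> B"
    using xA yB by simp_all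
  have iA: "insert x1 A13 \<inter> A12 = {}" "insert x2 A21 \<inter> A23 = {}" "insert x3 A32 \<inter> A31 = {}"
    using A1(2) A2(2) A3(2) nA by auto
  have iB: "insert y1 B31 \<inter> B21 = {}" "insert y2 B12 \<inter> B32 = {}" "insert y3 B23 \<inter> B13 = {}"
    using B1(2) B2(2) B3(2) nB by auto
  have join: "(U \<union> U') \<inter> (V \<union> V') = {}"
    if "U \<inter> V = {}" "U \<inter> V' = {}" "U' \<inter> V = {}" "U' \<inter> V' = {}" for U U' V V' :: "'a set"
    using that by blast
  show ?thesis
  proof (rule coverable_1_1_1[OF cov])
    show "((insert x3 A32 \<union> A23) \<union> (B32 \<union> insert y3 B23)) \<inter> ((insert x1 A13 \<union> A31) \<union> (B13 \<union> insert y1 B31)) = {}"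
    proof (rule disjoint_sides[OF sU(1,2,4,5)])
      show "(insert x3 A32 \<union> A23) \<inter> (insert x1 A13 \<union> A31) = {}"
        by (rule join[OF disj[OF sA(5,1)] iA(3) disj[OF sA(4,1)] disj[OF sA(4,6)]])
          (use dA(2-4) in \<open>simp_all add: Int_commute\<close>)
      show "(B32 \<union> insert y3 B23) \<inter> (B13 \<union> insert y1 B31) = {}"
        by (rule join[OF disj[OF sB(4,6)] disj[OF sB(4,1)] iB(3) disj[OF sB(5,1)]])
          (use dB(2-4) in \<open>simp_all add: Int_commute\<close>)
    qed
    show "((insert x3 A32 \<union> A23) \<union> (B32 \<union> insert y3 B23)) \<inter> ((insert x2 A21 \<union> A12) \<union> (B21 \<union> insert y2 B12)) = {}"
    proof (rule disjoint_sides[OF sU(1,3,4,6)])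
      show "(insert x3 A32 \<union> A23) \<inter> (insert x2 A21 \<union> A12) = {}"
        by (rule join[OF disj[OF sA(5,3)] disj[OF sA(5,2)] _ disj[OF sA(4,2)]])
          (use dA(2-4) iA(2) in \<open>simp_all add: Int_commute\<close>)
      show "(B32 \<union> insert y3 B23) \<inter> (B21 \<union> insert y2 B12) = {}"
        by (rule join[OF disj[OF sB(4,2)] _ disj[OF sB(5,2)] disj[OF sB(5,3)]])
          (use dB(2-4) iB(2) in \<open>simp_all add: Int_commute\<close>)
    qed
    show "((insert x1 A13 \<union> A31) \<union> (B13 \<union> insert y1 B31)) \<inter> ((insert x2 A21 \<union> A12) \<union> (B21 \<union> insert y2 B12)) = {}"
    proof (rule disjoint_sides[OF sU(2,3,5,6)])
      show "(insert x1 A13 \<union> A31) \<inter> (insert x2 A21 \<union> A12) = {}"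
        by (rule join[OF disj[OF sA(1,3)] iA(1) disj[OF sA(6,3)] disj[OF sA(6,2)]])
          (use dA(2-4) in \<open>simp_all add: Int_commute\<close>)
      show "(B13 \<union> insert y1 B31) \<inter> (B21 \<union> insert y2 B12) = {}"
        by (rule join[OF disj[OF sB(6,2)] disj[OF sB(6,3)] iB(1) disj[OF sB(1,3)]])
          (use dB(2-4) in \<open>simp_all add: Int_commute\<close>)
    qed
    show "A \<union> B = ((insert x3 A32 \<union> A23) \<union> (B32 \<union> insert y3 B23)) \<union>
        ((insert x1 A13 \<union> A31) \<union> (B13 \<union> insert y1 B31)) \<union>
        ((insert x2 A21 \<union> A12) \<union> (B21 \<union> insert y2 B12))"
      unfolding dA(1) dB(1) unfolding pA pB by blast
  qed
qed

lemma triangular_linked_coverable: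
  assumes tri: "triangular k1 k2 k3 A1 A2 A3 B1 B2 B3" and AB: "card A = card B"
    and l1: "\<exists>x \<in> A1. \<exists>y \<in> B1. E k2 x y" and l2: "\<exists>x \<in> A2. \<exists>y \<in> B2. E k3 x y"
    and l3: "\<exists>x \<in> A3. \<exists>y \<in> B3. E k1 x y"
  shows "coverable E 3 (A \<union> B)"
proof -
  note c = triangular_card(7,8)[OF tri]
  have tri2: "triangular k2 k3 k1 A2 A3 A1 B2 B3 B1" by (rule triangular_rotate[OF tri])
  have tri3: "triangular k3 k1 k2 A3 A1 A2 B3 B1 B2" by (rule triangular_rotate[OF tri2])
  obtain x1 y1 x2 y2 x3 y3 where l: "x1 \<in> A1" "y1 \<in> B1" "E k2 x1 y1"
    "x2 \<in> A2" "y2 \<in> B2" "E k3 x2 y2" "x3 \<in> A3" "y3 \<in> B3" "E k1 x3 y3"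
    using l1 l2 l3 by blast
  have ne: "A1 \<noteq> {}" "A2 \<noteq> {}" "A3 \<noteq> {}" "B1 \<noteq> {}" "B2 \<noteq> {}" "B3 \<noteq> {}" using l by auto
  consider "card B2 + card B3 \<le> card A1" | "card B3 + card B1 \<le> card A2" | "card B1 + card B2 \<le> card A3"
    | "card A1 + card B1 < card A" "card A2 + card B2 < card A" "card A3 + card B3 < card A"
    using c AB by linarith
  then show ?thesis
  proof cases
    case 1
    show ?thesis by (rule triangular_dominant_coverable[OF tri AB l(1-3) ne(3,6) 1])
  next
    case 2
    show ?thesis by (rule triangular_dominant_coverable[OF tri2 AB l(4-6) ne(1,4) 2])
  next
    case 3
    show ?thesis by (rule triangular_dominant_coverable[OF tri3 AB l(7-9) ne(2,5) 3])
  next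
    case 4
    show ?thesis by (rule triangular_linked_transport_coverable[OF tri AB l 4])
  qed
qed

text \<open>Links can be assigned cyclically in two directions. If both fail, each failure makes one
  pair \<open>Ai\<close>, \<open>Bi\<close> monochromatic. The two pairs have different indices, as
  a nonempty pair cannot be complete in two colours; their colours either agree or differ, which are
  the two special lemmas.\<close>

lemma triangular_coverable:
  assumes tri: "triangular k1 k2 k3 A1 A2 A3 B1 B2 B3" and AB: "card A = card B"
    and ne: "A1 \<noteq> {}" "A2 \<noteq> {}" "A3 \<noteq> {}" "B1 \<noteq> {}" "B2 \<noteq> {}" "B3 \<noteq> {}"
  shows "coverable E 3 (A \<union> B)"
proof -
  have tri2: "triangular k2 k3 k1 A2 A3 A1 B2 B3 B1" by (rule triangular_rotate[OF tri])
  have tri3: "triangular k3 k1 k2 A3 A1 A2 B3 B1 B2" by (rule triangular_rotate[OF tri2])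
  have trit: "triangular k1 k3 k2 A1 A3 A2 B1 B3 B2" by (rule triangular_transpose[OF tri])
  let ?c = "\<lambda>k X Y. complete_in (E k) X Y"
  have k: "k1 \<noteq> k2" "k1 \<noteq> k3" "k2 \<noteq> k3"
    and two: "\<forall>x \<in> A1. \<forall>y \<in> B1. E k2 x y \<or> E k3 x y" "\<forall>x \<in> A2. \<forall>y \<in> B2. E k3 x y \<or> E k1 x y"
      "\<forall>x \<in> A3. \<forall>y \<in> B3. E k1 x y \<or> E k2 x y"
    using tri unfolding triangular_def by auto
  have excl: False if "?c i X Y" "?c j X Y" "i \<noteq> j" "X \<noteq> {}" "Y \<noteq> {}" for i j X Y
    using that E_unique unfolding complete_in_def by blast
  show ?thesis
  proof (cases "(\<exists>x \<in> A1. \<exists>y \<in> B1. E k2 x y) \<and> (\<exists>x \<in> A2. \<exists>y \<in> B2. E k3 x y) \<and>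
      (\<exists>x \<in> A3. \<exists>y \<in> B3. E k1 x y)")
    case True
    then show ?thesis using triangular_linked_coverable[OF tri AB] by blast
  next
    case False
    then have or1: "?c k3 A1 B1 \<or> ?c k1 A2 B2 \<or> ?c k2 A3 B3"
      using two unfolding complete_in_def by blast
    show ?thesis
    proof (cases "(\<exists>x \<in> A1. \<exists>y \<in> B1. E k3 x y) \<and> (\<exists>x \<in> A3. \<exists>y \<in> B3. E k2 x y) \<and>
        (\<exists>x \<in> A2. \<exists>y \<in> B2. E k1 x y)")
      case True
      then show ?thesis using triangular_linked_coverable[OF trit AB] by blast
    next
      case False
      then have or2: "?c k2 A1 B1 \<or> ?c k1 A3 B3 \<or> ?c k3 A2 B2"
        using two unfolding complete_in_def by blast
      note equal = triangular_two_equal_coverable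
      note distinct = triangular_two_distinct_coverable
      from or1 show ?thesis
      proof (elim disjE)
        assume c: "?c k3 A1 B1"
        from or2 show ?thesis
        proof (elim disjE)
          assume "?c k2 A1 B1"
          then show ?thesis using excl c k ne by blast
        next
          assume "?c k1 A3 B3"
          then show ?thesis by (rule distinct[OF tri2 AB c])
        next
          assume "?c k3 A2 B2"
          then show ?thesis by (rule equal[OF tri AB c])
        qed
      next
        assume c: "?c k1 A2 B2"
        from or2 show ?thesis
        proof (elim disjE)
          assume "?c k2 A1 B1"
          then show ?thesis by (rule distinct[OF tri3 AB c])
        next
          assume "?c k1 A3 B3"
          then show ?thesis by (rule equal[OF tri2 AB c])
        next
          assume "?c k3 A2 B2"
          then show ?thesis using excl c k ne by blast
        qed
      next
        assume c: "?c k2 A3 B3"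
        from or2 show ?thesis
        proof (elim disjE)
          assume "?c k2 A1 B1"
          then show ?thesis by (rule equal[OF tri3 AB c])
        next
          assume "?c k1 A3 B3"
          then show ?thesis using excl c k ne by blast
        next
          assume "?c k3 A2 B2"
          then show ?thesis by (rule distinct[OF tri AB c])
        qed
      qed
    qed
  qed
qed

end

section \<open>Palettes\<close>

lemma meets_adjacent_pairs:
  assumes "card X = 2" "X \<inter> {p, q} \<noteq> {}" "X \<inter> {p, r} \<noteq> {}" "q \<noteq> r"
  shows "p \<in> X \<or> X = {q, r}"
proof -
  obtain u v where "X = {u, v}" using assms(1) by (auto simp: card_2_iff)
  then show ?thesis using assms by auto
qed

lemma meets_disjoint_pairs:
  assumes "card X = 2" "X \<inter> {i, j} \<noteq> {}" "X \<inter> {k, l} \<noteq> {}" "{i, j} \<inter> {k, l} = {}"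
  shows "X \<in> {{i, k}, {i, l}, {j, k}, {j, l}}"
proof -
  obtain u v where "X = {u, v}" using assms(1) by (auto simp: card_2_iff)
  then show ?thesis using assms(2-4) by (auto simp: insert_commute)
qed

lemma overlapping_pairs:
  assumes "card X = 2" "card Y = 2" "X \<noteq> Y" "X \<inter> Y \<noteq> {}"
  obtains p q r where "X = {p, q}" "Y = {p, r}" "p \<noteq> q" "p \<noteq> r" "q \<noteq> r"
proof -
  obtain u v where u: "X = {u, v}" "u \<noteq> v" using assms(1) by (auto simp: card_2_iff)
  obtain w z where w: "Y = {w, z}" "w \<noteq> z" using assms(2) by (auto simp: card_2_iff)
  consider "u = w" | "u = z" | "v = w" | "v = z" using assms(4) u w by auto
  then show thesis
    using that[of u v z] that[of u v w] that[of v u z] that[of v u w] u w assms(3)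
    by cases (auto simp: insert_commute)
qed

text \<open>
  The palette \<open>S v\<close> has exactly two colours: it is the set of colours at \<open>v\<close>, padded if necessary.
\<close>

locale two_local_colouring = bipartite_colouring E A B
  for E :: "'c \<Rightarrow> 'a \<Rightarrow> 'a \<Rightarrow> bool" and A B :: "'a set" +
  fixes S :: "'a \<Rightarrow> 'c set"
  assumes card_AB: "card A = card B"
    and card_S: "v \<in> A \<union> B \<Longrightarrow> card (S v) = 2"
    and E_palette: "E k u v \<Longrightarrow> k \<in> S u"
begin

lemma swap_sides_two_local: "two_local_colouring E B A S"
proof -
  interpret swap: bipartite_colouring E B A by (rule swap_sides)
  show ?thesis by standard (use card_AB card_S E_palette in auto)
qed

lemma E_palettes: "E k u v \<Longrightarrow> k \<in> S u \<inter> S v"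
  using E_palette E_sym by blast

lemma palettes_meet: "x \<in> A \<Longrightarrow> y \<in> B \<Longrightarrow> S x \<inter> S y \<noteq> {}"
  using E_total E_palettes by blast

lemma palette_cases: "x \<in> A \<Longrightarrow> y \<in> B \<Longrightarrow> S x \<inter> S y \<subseteq> {k, l} \<Longrightarrow> E k x y \<or> E l x y"
  using E_total[of x y] E_palettes by blast

lemma palette_forced: "x \<in> A \<Longrightarrow> y \<in> B \<Longrightarrow> S x \<inter> S y \<subseteq> {k} \<Longrightarrow> E k x y"
  using palette_cases[of x y k k] by simp

lemma palette_complete:
  "X \<inter> Y \<subseteq> {k} \<Longrightarrow> complete_in (E k) {x \<in> A. S x = X} {y \<in> B. S y = Y}"
  unfolding complete_in_def using palette_forced by simp

lemma palette_disjoint: "X \<noteq> Y \<Longrightarrow> {v \<in> C. S v = X} \<inter> {v \<in> C. S v = Y} = {}"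
  by auto

section \<open>Palette configurations\<close>

lemma common_colour_coverable:
  assumes "\<And>v. v \<in> A \<union> B \<Longrightarrow> k \<in> S v"
  shows "coverable E 3 (A \<union> B)"
proof -
  have other: "i = j" if v: "v \<in> A \<union> B" "i \<in> S v" "j \<in> S v" "i \<noteq> k" "j \<noteq> k" for v i j
  proof -
    obtain p q where "S v = {p, q}" using card_S[OF v(1)] by (auto simp: card_2_iff)
    then show ?thesis using assms[OF v(1)] v by auto
  qed
  show ?thesis
  proof (rule star_coverable[OF subset_refl subset_refl card_AB, where k = k])
    show "i = j" if "x \<in> A" "E i x y" "E j x y'" "i \<noteq> k" "j \<noteq> k" for x y y' i j
      using other[of x i j] E_palettes that by blast
    show "i = j" if "y \<in> B" "E i x y" "E j x' y" "i \<noteq> k" "j \<noteq> k" for x x' y i j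
      using other[of y i j] E_palettes that by blast
  qed
qed

lemma constant_palette_coverable:
  assumes "\<And>x. x \<in> A \<Longrightarrow> S x = {k, l}"
  shows "coverable E 3 (A \<union> B)"
proof (rule two_colours_coverable[OF subset_refl subset_refl card_AB])
  show "E k x y \<or> E l x y" if "x \<in> A" "y \<in> B" for x y
    by (rule palette_cases) (use that assms in auto)
qed

lemma forked_palettes_coverable:
  assumes d: "h \<noteq> i" "h \<noteq> j" "i \<noteq> j"
    and SA: "\<And>x. x \<in> A \<Longrightarrow> S x = {h, i} \<or> S x = {h, j}"
    and SB: "\<And>y. y \<in> B \<Longrightarrow> h \<in> S y \<or> S y = {i, j}"
  shows "coverable E 3 (A \<union> B)"
proof -
  define A2 where "A2 = {x \<in> A. S x = {h, i}}"
  define A3 where "A3 = {x \<in> A. S x = {h, j}}"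
  define B1 where "B1 = {y \<in> B. S y = {i, j}}"
  define B' where "B' = {y \<in> B. h \<in> S y}"
  have "{h, i} \<noteq> {h, j}" using d by (auto simp: doubleton_eq_iff)
  show ?thesis
  proof (rule forked_coverable[of A2 A3 B1 B' i j h])
    show "A = A2 \<union> A3" "B = B1 \<union> B'" unfolding A2_def A3_def B1_def B'_def using SA SB by blast+
    show "A2 \<inter> A3 = {}" unfolding A2_def A3_def using \<open>{h, i} \<noteq> {h, j}\<close> by auto
    show "card A = card B" by (rule card_AB)
    show "complete_in (E i) A2 B1" "complete_in (E j) A3 B1"
      unfolding complete_in_def A2_def A3_def B1_def
      using d by (auto intro!: palette_forced)
    show "E h a b \<or> E i a b" if "a \<in> A2" "b \<in> B'" for a b
      by (rule palette_cases) (use that in \<open>auto simp: A2_def B'_def\<close>)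
    show "E h a b \<or> E j a b" if "a \<in> A3" "b \<in> B'" for a b
      by (rule palette_cases) (use that in \<open>auto simp: A3_def B'_def\<close>)
    show "complete_in (E h) A2 {b} \<or> complete_in (E h) A3 {b}" if "b \<in> B'" for b
    proof -
      have b: "b \<in> B" "h \<in> S b" using that by (auto simp: B'_def)
      obtain p q where "S b = {p, q}" using card_S[of b] b by (auto simp: card_2_iff)
      \<comment> \<open>The palette of \<open>b\<close> has two elements and one of them is
        \<open>h\<close>.\<close>
      then have "i \<notin> S b \<or> j \<notin> S b" using b d by auto
      then show ?thesis
      proof
        assume "i \<notin> S b"
        then have "complete_in (E h) A2 {b}"
          unfolding complete_in_def A2_def using b by (auto intro!: palette_forced)
        then show ?thesis ..
      next
        assume "j \<notin> S b"
        then have "complete_in (E h) A3 {b}"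
          unfolding complete_in_def A3_def using b by (auto intro!: palette_forced)
        then show ?thesis ..
      qed
    qed
  qed
qed

text \<open>Only the palette \<open>{i, l}\<close> occurs on both sides, so only those vertices
  leave a choice of colour. The extreme classes meet in \<open>j\<close> alone or in
  \<open>k\<close> alone, hence the values of \<open>s\<close> and \<open>t\<close>.\<close>

lemma threaded_palettes_coverable:
  assumes d: "distinct [i, j, k, l]"
    and SA: "\<And>x. x \<in> A \<Longrightarrow> S x = {i, j} \<or> S x = {i, l} \<or> S x = {k, l}"
    and SB: "\<And>y. y \<in> B \<Longrightarrow> S y = {i, k} \<or> S y = {i, l} \<or> S y = {j, l}"
  shows "coverable E 3 (A \<union> B)"
proof (rule threaded_coverable[where Ap = "{x \<in> A. S x = {i, j}}" and Af = "{x \<in> A. S x = {i, l}}"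
      and Aq = "{x \<in> A. S x = {k, l}}" and Bp = "{y \<in> B. S y = {i, k}}"
      and Bf = "{y \<in> B. S y = {i, l}}" and Bq = "{y \<in> B. S y = {j, l}}"
      and i = i and l = l and s = j and t = k])
  show "E i x y \<or> E l x y" if "x \<in> {x \<in> A. S x = {i, l}}" "y \<in> {y \<in> B. S y = {i, l}}" for x y
    by (rule palette_cases) (use that in auto)
  show "A = {x \<in> A. S x = {i, j}} \<union> {x \<in> A. S x = {i, l}} \<union> {x \<in> A. S x = {k, l}}"
    using SA by blast
  show "B = {y \<in> B. S y = {i, k}} \<union> {y \<in> B. S y = {i, l}} \<union> {y \<in> B. S y = {j, l}}"
    using SB by blast
  show "complete_in (E i) ({x \<in> A. S x = {i, j}} \<union> {x \<in> A. S x = {i, l}}) {y \<in> B. S y = {i, k}}"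
    "complete_in (E l) ({x \<in> A. S x = {i, l}} \<union> {x \<in> A. S x = {k, l}}) {y \<in> B. S y = {j, l}}"
    unfolding complete_in_Un using d by (simp_all add: palette_complete)
  show "i \<noteq> l" using d by simp
qed (rule palette_disjoint palette_complete card_AB; use d in \<open>simp add: doubleton_eq_iff\<close>)+

text \<open>Each palette on \<open>B\<close> has exactly one of \<open>i\<close>, \<open>j\<close>
  and exactly one of \<open>k\<close>, \<open>l\<close>; these are the two partitions of
  \<open>B\<close> seen by the two classes of \<open>A\<close>.\<close>

lemma split_palettes_coverable:
  assumes d: "distinct [i, j, k, l]"
    and SA: "\<And>x. x \<in> A \<Longrightarrow> S x = {i, j} \<or> S x = {k, l}"
    and SB: "\<And>y. y \<in> B \<Longrightarrow> S y \<in> {{i, k}, {i, l}, {j, k}, {j, l}}"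
  shows "coverable E 3 (A \<union> B)"
proof (rule split_side_coverable[where Ap = "{x \<in> A. S x = {i, j}}" and Aq = "{x \<in> A. S x = {k, l}}"
      and ?B1.0 = "{y \<in> B. i \<in> S y}" and ?B2.0 = "{y \<in> B. j \<in> S y}"
      and ?B3.0 = "{y \<in> B. k \<in> S y}" and ?B4.0 = "{y \<in> B. l \<in> S y}"
      and i = i and j = j and k = k and l = l])
  show "A = {x \<in> A. S x = {i, j}} \<union> {x \<in> A. S x = {k, l}}"
    using SA by blast
  have B: "(i \<in> S y \<and> j \<notin> S y \<or> j \<in> S y \<and> i \<notin> S y) \<and> (k \<in> S y \<and> l \<notin> S y \<or> l \<in> S y \<and> k \<notin> S y)"
    if "y \<in> B" for y
  proof -
    have "S y = {i, k} \<or> S y = {i, l} \<or> S y = {j, k} \<or> S y = {j, l}"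
      using SB[OF that] by simp
    then show ?thesis
      by (elim disjE; use d in auto)
  qed
  show "B = {y \<in> B. i \<in> S y} \<union> {y \<in> B. j \<in> S y}" "{y \<in> B. i \<in> S y} \<inter> {y \<in> B. j \<in> S y} = {}"
    "B = {y \<in> B. k \<in> S y} \<union> {y \<in> B. l \<in> S y}" "{y \<in> B. k \<in> S y} \<inter> {y \<in> B. l \<in> S y} = {}"
    using B by blast+
  show "complete_in (E i) {x \<in> A. S x = {i, j}} {y \<in> B. i \<in> S y}"
    "complete_in (E j) {x \<in> A. S x = {i, j}} {y \<in> B. j \<in> S y}"
    "complete_in (E k) {x \<in> A. S x = {k, l}} {y \<in> B. k \<in> S y}"
    "complete_in (E l) {x \<in> A. S x = {k, l}} {y \<in> B. l \<in> S y}"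
  proof -
    have forced: "E p x y" if "x \<in> A" "S x = {p, q} \<or> S x = {q, p}" "y \<in> B" "q \<notin> S y" for p q x y
      by (rule palette_forced) (use that in auto)
    show "complete_in (E i) {x \<in> A. S x = {i, j}} {y \<in> B. i \<in> S y}"
      "complete_in (E j) {x \<in> A. S x = {i, j}} {y \<in> B. j \<in> S y}"
      "complete_in (E k) {x \<in> A. S x = {k, l}} {y \<in> B. k \<in> S y}"
      "complete_in (E l) {x \<in> A. S x = {k, l}} {y \<in> B. l \<in> S y}"
      unfolding complete_in_def using forced B by blast+
  qed
  show "{x \<in> A. S x = {i, j}} \<inter> {x \<in> A. S x = {k, l}} = {}"
    by (rule palette_disjoint) (use d in \<open>simp add: doubleton_eq_iff\<close>)
qed (rule card_AB)

lemma triangular_palettes_coverable: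
  assumes d: "distinct [i, j, k]"
    and SA: "\<And>x. x \<in> A \<Longrightarrow> S x = {i, j} \<or> S x = {i, k} \<or> S x = {j, k}"
    and SB: "\<And>y. y \<in> B \<Longrightarrow> S y = {i, j} \<or> S y = {i, k} \<or> S y = {j, k}"
    and ne: "{i, j} \<in> S ` A" "{i, k} \<in> S ` A" "{j, k} \<in> S ` A"
      "{i, j} \<in> S ` B" "{i, k} \<in> S ` B" "{j, k} \<in> S ` B"
  shows "coverable E 3 (A \<union> B)"
proof (rule triangular_coverable[OF _ card_AB])
  let ?A = "\<lambda>p q. {x \<in> A. S x = {p, q}}" and ?B = "\<lambda>p q. {y \<in> B. S y = {p, q}}"
  have "A = ?A j k \<union> ?A i k \<union> ?A i j" "B = ?B j k \<union> ?B i k \<union> ?B i j"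
    using SA SB by blast+
  moreover have "E p x y \<or> E q x y" if "x \<in> ?A p q" "y \<in> ?B p q" for p q x y
    by (rule palette_cases) (use that in auto)
  ultimately show "triangular i j k (?A j k) (?A i k) (?A i j) (?B j k) (?B i k) (?B i j)"
    unfolding triangular_def complete_in_def
    using d by (auto simp: doubleton_eq_iff intro!: palette_forced)
  show "?A j k \<noteq> {}" "?A i k \<noteq> {}" "?A i j \<noteq> {}" "?B j k \<noteq> {}" "?B i k \<noteq> {}" "?B i j \<noteq> {}"
    using ne by (auto simp: image_iff)
qed

text \<open>Each side is confined to a 4-cycle of palettes. \<open>{i, l}\<close> on one side
  excludes \<open>{j, k}\<close> on the other, so either one side has just its two disjoint
  palettes, or both sides have a third palette, which is the same on both and is the only extra
  one.\<close>

lemma crossing_palettes_coverable: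
  assumes d: "distinct [i, j, k, l]"
    and a: "a \<in> A" "S a = {i, j}" "a' \<in> A" "S a' = {k, l}"
    and b: "b \<in> B" "S b = {i, k}" "b' \<in> B" "S b' = {j, l}"
  shows "coverable E 3 (A \<union> B)"
proof -
  interpret swap: two_local_colouring E B A S by (rule swap_sides_two_local)
  have SB: "S y \<in> {{i, k}, {i, l}, {j, k}, {j, l}}" if "y \<in> B" for y
  proof (rule meets_disjoint_pairs)
    show "S y \<inter> {i, j} \<noteq> {}" "S y \<inter> {k, l} \<noteq> {}"
      using palettes_meet[OF a(1) that] palettes_meet[OF a(3) that] a(2,4) by auto
  qed (use card_S that d in auto)
  have SA: "S x \<in> {{i, j}, {i, l}, {k, j}, {k, l}}" if "x \<in> A" for x
  proof (rule meets_disjoint_pairs)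
    show "S x \<inter> {i, k} \<noteq> {}" "S x \<inter> {j, l} \<noteq> {}"
      using palettes_meet[OF that b(1)] palettes_meet[OF that b(3)] b(2,4) by auto
  qed (use card_S that d in auto)
  have il_jk: False if "x \<in> A" "y \<in> B" "S x = {i, l} \<and> S y = {j, k} \<or> S x = {k, j} \<and> S y = {i, l}" for x y
    using palettes_meet[OF that(1,2)] that(3) d by auto
  show ?thesis
  proof (cases "(\<forall>x \<in> A. S x = {i, j} \<or> S x = {k, l}) \<or> (\<forall>y \<in> B. S y = {i, k} \<or> S y = {j, l})")
    case True
    then show ?thesis
    proof
      assume "\<forall>x \<in> A. S x = {i, j} \<or> S x = {k, l}"
      then show ?thesis using SB by (intro split_palettes_coverable[OF d]) blast+
    next
      assume "\<forall>y \<in> B. S y = {i, k} \<or> S y = {j, l}"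
      then have "coverable E 3 (B \<union> A)"
        using SA d by (intro swap.split_palettes_coverable[of i k j l]) auto
      then show ?thesis by (simp add: Un_commute)
    qed
  next
    case False
    then obtain x y where x: "x \<in> A" "S x = {i, l} \<or> S x = {k, j}"
      and y: "y \<in> B" "S y = {i, l} \<or> S y = {j, k}"
      using SA SB by (metis (no_types, lifting) insertE singletonD)
    have "S x = {i, l} \<and> S y = {i, l} \<or> S x = {k, j} \<and> S y = {j, k}"
      using x y il_jk[OF x(1) y(1)] by blast
    then show ?thesis
    proof (elim disjE conjE)
      assume xy: "S x = {i, l}" "S y = {i, l}"
      show ?thesis
      proof (rule threaded_palettes_coverable[OF d])
        show "S u = {i, j} \<or> S u = {i, l} \<or> S u = {k, l}" if "u \<in> A" for u
        proof -
          have "S u \<noteq> {k, j}" using il_jk[OF that y(1)] xy(2) by metis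
          then show ?thesis using SA[OF that] by simp
        qed
        show "S u = {i, k} \<or> S u = {i, l} \<or> S u = {j, l}" if "u \<in> B" for u
        proof -
          have "S u \<noteq> {j, k}" using il_jk[OF x(1) that] xy(1) by metis
          then show ?thesis using SB[OF that] by simp
        qed
      qed
    next
      assume xy: "S x = {k, j}" "S y = {j, k}"
      show ?thesis
      proof (rule threaded_palettes_coverable[of j i l k])
        show "distinct [j, i, l, k]" using d by auto
        show "S u = {j, i} \<or> S u = {j, k} \<or> S u = {l, k}" if "u \<in> A" for u
        proof -
          have "S u \<noteq> {i, l}" using il_jk[OF that y(1)] xy(2) by metis
          then show ?thesis
            using SA[OF that] unfolding insert_iff empty_iff by (metis insert_commute)
        qed
        show "S u = {j, l} \<or> S u = {j, k} \<or> S u = {i, k}" if "u \<in> B" for u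
        proof -
          have "S u \<noteq> {i, l}" using il_jk[OF x(1) that] xy(1) by metis
          then show ?thesis
            using SB[OF that] unfolding insert_iff empty_iff by (metis insert_commute)
        qed
      qed
    qed
  qed
qed

text \<open>The palettes on \<open>B\<close> are edges of the 4-cycle \<open>i\<close>,
  \<open>k\<close>, \<open>j\<close>, \<open>l\<close>. If two of them are disjoint, the crossing
  case applies. Otherwise there are at most two, sharing a colour, because a 4-cycle contains no
  triangle.\<close>

lemma disjoint_palettes_coverable:
  assumes a: "a \<in> A" "a' \<in> A" "S a \<inter> S a' = {}"
  shows "coverable E 3 (A \<union> B)"
proof -
  interpret swap: two_local_colouring E B A S by (rule swap_sides_two_local)
  obtain i j where ij: "S a = {i, j}" "i \<noteq> j" using card_S[of a] a by (auto simp: card_2_iff)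
  obtain k l where kl: "S a' = {k, l}" "k \<noteq> l" using card_S[of a'] a by (auto simp: card_2_iff)
  have d: "distinct [i, j, k, l]" using ij kl a by auto
  have SB: "S y = {i, k} \<or> S y = {i, l} \<or> S y = {j, k} \<or> S y = {j, l}" if "y \<in> B" for y
    using meets_disjoint_pairs[of "S y" i j k l] card_S[of y] that a ij kl palettes_meet[of a y]
      palettes_meet[of a' y] d by (simp add: Int_commute)
  show ?thesis
  proof (cases "\<exists>b \<in> B. \<exists>b' \<in> B. S b \<inter> S b' = {}")
    case True
    then obtain b b' where b: "b \<in> B" "b' \<in> B" "S b \<inter> S b' = {}" by blast
    have "\<exists>b \<in> B. \<exists>b' \<in> B. S b = {i, k} \<and> S b' = {j, l} \<or> S b = {i, l} \<and> S b' = {j, k}"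
      using SB[OF b(1)] SB[OF b(2)] b by (elim disjE) (simp_all, (blast)+)
    then obtain b b' where "b \<in> B" "b' \<in> B" "S b = {i, k} \<and> S b' = {j, l} \<or> S b = {i, l} \<and> S b' = {j, k}"
      by blast
    then show ?thesis
      using crossing_palettes_coverable[OF d a(1) ij(1) a(2) kl(1)]
        crossing_palettes_coverable[of i j l k a a' b b'] d a ij kl by (auto simp: insert_commute)
  next
    case meet: False
    show ?thesis
    proof (cases "\<exists>b \<in> B. \<exists>b' \<in> B. S b \<noteq> S b'")
      case True
      then obtain b b' where b: "b \<in> B" "b' \<in> B" "S b \<noteq> S b'" by blast
      then obtain p q r where pqr: "S b = {p, q}" "S b' = {p, r}" "p \<noteq> q" "p \<noteq> r" "q \<noteq> r"
        using overlapping_pairs[of "S b" "S b'"] card_S meet by (metis UnCI)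
      have SBp: "S y = {p, q} \<or> S y = {p, r}" if y: "y \<in> B" for y
      proof -
        have m: "S y \<inter> S b \<noteq> {}" "S y \<inter> S b' \<noteq> {}" using meet y b by blast+
        show ?thesis
          using SB[OF y] SB[OF b(1)] SB[OF b(2)] m b(3) d pqr
          by (elim disjE) (auto simp: doubleton_eq_iff insert_commute)
      qed
      have "coverable E 3 (B \<union> A)"
      proof (rule swap.forked_palettes_coverable[OF pqr(3-5)])
        show "S x = {p, q} \<or> S x = {p, r}" if "x \<in> B" for x by (rule SBp[OF that])
        show "p \<in> S y \<or> S y = {q, r}" if "y \<in> A" for y
          using meets_adjacent_pairs[of "S y" p q r] card_S[of y] palettes_meet[of y b]
            palettes_meet[of y b'] that b pqr by auto
      qed
      then show ?thesis by (simp add: Un_commute)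
    next
      case False
      obtain y where y: "y \<in> B" using a(1) card_AB finite_A by (metis card_eq_0_iff equals0I finite_B empty_iff)
      obtain p q where "S y = {p, q}" using card_S[of y] y by (auto simp: card_2_iff)
      then have "coverable E 3 (B \<union> A)"
        using False y by (intro swap.constant_palette_coverable[of p q]) blast
      then show ?thesis by (simp add: Un_commute)
    qed
  qed
qed

text \<open>Two distinct palettes \<open>{p, q}\<close>, \<open>{p, r}\<close> on \<open>A\<close>
  make \<open>{q, r}\<close> the only possible palette without \<open>p\<close>, on either side.
  Where it occurs, the opposite side is confined to the three pairs from \<open>p\<close>,
  \<open>q\<close>, \<open>r\<close>, so its presence on each side decides between common colour,
  fork and triangle.\<close>

lemma two_local_coverable: "coverable E 3 (A \<union> B)"
proof -
  interpret swap: two_local_colouring E B A S by (rule swap_sides_two_local)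
  have sw: "coverable E 3 (A \<union> B)" if "coverable E 3 (B \<union> A)"
    using that by (simp add: Un_commute)
  show ?thesis
  proof (cases "\<exists>a \<in> A. \<exists>a' \<in> A. S a \<inter> S a' = {}")
    case True
    then show ?thesis using disjoint_palettes_coverable by blast
  next
    case meetA: False
    show ?thesis
    proof (cases "\<exists>a \<in> A. \<exists>a' \<in> A. S a \<noteq> S a'")
      case False
      show ?thesis
      proof (cases "A = {}")
        case True
        then show ?thesis by (intro constant_palette_coverable) auto
      next
        case ne: False
        then obtain x where x: "x \<in> A" by blast
        obtain p q where "S x = {p, q}" using card_S[of x] x by (auto simp: card_2_iff)
        then show ?thesis using False x by (intro constant_palette_coverable[of p q]) blast
      qed
    next
      case True
      then obtain a a' where a: "a \<in> A" "a' \<in> A" "S a \<noteq> S a'" by blast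
      then obtain p q r where pqr: "S a = {p, q}" "S a' = {p, r}" "p \<noteq> q" "p \<noteq> r" "q \<noteq> r"
        using overlapping_pairs[of "S a" "S a'"] card_S meetA by (metis UnCI)
      have SA: "p \<in> S x \<or> S x = {q, r}" if "x \<in> A" for x
      proof (rule meets_adjacent_pairs)
        show "S x \<inter> {p, q} \<noteq> {}" "S x \<inter> {p, r} \<noteq> {}"
          using meetA that a(1,2) unfolding pqr(1,2)[symmetric] by blast+
      qed (use card_S that pqr in auto)
      have SB: "p \<in> S y \<or> S y = {q, r}" if "y \<in> B" for y
      proof (rule meets_adjacent_pairs)
        show "S y \<inter> {p, q} \<noteq> {}" "S y \<inter> {p, r} \<noteq> {}"
          using palettes_meet[OF a(1) that] palettes_meet[OF a(2) that]
          unfolding pqr(1,2)[symmetric] by blast+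
      qed (use card_S that pqr in auto)
      have pq_pr: "S v = {p, q} \<or> S v = {p, r}" if v: "v \<in> A \<union> B" "p \<in> S v" "S v \<inter> {q, r} \<noteq> {}" for v
      proof -
        obtain s t where "S v = {s, t}" "s \<noteq> t" using card_S[OF v(1)] by (auto simp: card_2_iff)
        then show ?thesis using v(2,3) pqr(3-5) by (auto simp: insert_commute)
      qed
      show ?thesis
      proof (cases "\<exists>y \<in> B. S y = {q, r}")
        case False
        show ?thesis
        proof (cases "\<exists>x \<in> A. S x = {q, r}")
          case True
          then obtain x where x: "x \<in> A" "S x = {q, r}" by blast
          show ?thesis
          proof (rule sw, rule swap.forked_palettes_coverable[OF pqr(3-5)])
            show "S y = {p, q} \<or> S y = {p, r}" if "y \<in> B" for y
            proof -
              have "S y \<inter> {q, r} \<noteq> {}" using palettes_meet[OF x(1) that] x(2) by auto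
              then show ?thesis using SB[OF that] pq_pr[of y] False that by (metis UnI2)
            qed
          qed (rule SA)
        next
          case noA: False
          show ?thesis
          proof (rule common_colour_coverable[of p])
            show "p \<in> S v" if "v \<in> A \<union> B" for v
              using that SA[of v] SB[of v] False noA by (elim UnE) metis+
          qed
        qed
      next
        case True
        then obtain b where b: "b \<in> B" "S b = {q, r}" by blast
        have SA': "S x = {p, q} \<or> S x = {p, r} \<or> S x = {q, r}" if "x \<in> A" for x
        proof -
          have "S x \<inter> {q, r} \<noteq> {}" using palettes_meet[OF that b(1)] b(2) by simp
          then show ?thesis using SA[OF that] pq_pr[of x] that by (metis UnI1)
        qed
        show ?thesis
        proof (cases "\<exists>x \<in> A. S x = {q, r}")
          case False
          show ?thesis
            by (rule forked_palettes_coverable[OF pqr(3-5)]) (use SA' SB False in metis)+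
        next
          case True
          then obtain a'' where a'': "a'' \<in> A" "S a'' = {q, r}" by blast
          have SB': "S y = {p, q} \<or> S y = {p, r} \<or> S y = {q, r}" if "y \<in> B" for y
          proof -
            have "S y \<inter> {q, r} \<noteq> {}" using palettes_meet[OF a''(1) that] a''(2) by auto
            then show ?thesis using SB[OF that] pq_pr[of y] that by (metis UnI2)
          qed
          \<comment> \<open>A pair missing on \<open>B\<close> leaves two pairs with a common
            colour, which becomes the centre of a fork: \<open>r\<close> without
            \<open>{p, q}\<close>, \<open>q\<close> without \<open>{p, r}\<close>.\<close>
          consider "{p, q} \<in> S ` B" "{p, r} \<in> S ` B" | "{p, q} \<notin> S ` B" | "{p, r} \<notin> S ` B" by blast
          then show ?thesis
          proof cases
            case 1
            show ?thesis
            proof (rule triangular_palettes_coverable[OF _ SA' SB' _ _ _ 1])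
              show "{p, q} \<in> S ` A" "{p, r} \<in> S ` A" "{q, r} \<in> S ` A" "{q, r} \<in> S ` B"
                using a a'' b pqr by (metis imageI)+
            qed (use pqr in auto)
          next
            case 2
            show ?thesis
            proof (rule sw, rule swap.forked_palettes_coverable[of r p q])
              show "S y = {r, p} \<or> S y = {r, q}" if "y \<in> B" for y
                using SB'[OF that] 2 that by (auto simp: insert_commute)
              show "r \<in> S x \<or> S x = {p, q}" if "x \<in> A" for x
                using SA'[OF that] by auto
            qed (use pqr in auto)
          next
            case 3
            show ?thesis
            proof (rule sw, rule swap.forked_palettes_coverable[of q p r])
              show "S y = {q, p} \<or> S y = {q, r}" if "y \<in> B" for y
                using SB'[OF that] 3 that by (auto simp: insert_commute)
              show "q \<in> S x \<or> S x = {p, r}" if "x \<in> A" for x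
                using SA'[OF that] by auto
            qed (use pqr in auto)
          qed
        qed
      qed
    qed
  qed
qed

end

section \<open>Transfer to graphs\<close>

lemma successively_vwalk_arcs:
  "successively R p \<longleftrightarrow> (\<forall>(u, v) \<in> set (vwalk_arcs p). R u v)"
  by (induction p rule: vwalk_arcs.induct) auto

lemma ham_path_monochromatic:
  assumes "ham_path (\<lambda>k u v. (u, v) \<in> arcs_ends G \<and> c {u, v} = k) k u X v" "X \<subseteq> verts G"
  shows "\<exists>p. monochromatic_path G c p \<and> set p = X"
proof -
  obtain p where p: "p \<noteq> []" "distinct p" "set p = X"
    "\<forall>(u, v) \<in> set (vwalk_arcs p). (u, v) \<in> arcs_ends G \<and> c {u, v} = k"
    using assms(1) unfolding ham_path_def successively_vwalk_arcs by blast
  have "vpath p G" using p assms(2) by (auto intro!: vpathI vwalkI)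
  moreover have "c e = k" if "e \<in> path_edges p" for e
    using that p(4) by (auto simp: path_edges_def)
  ultimately show ?thesis using p(3) unfolding monochromatic_path_def by auto
qed

lemma obtain_pair_superset:
  fixes k k' :: 'a and X :: "'a set"
  assumes "finite X" "card X \<le> 2" "k \<noteq> k'"
  obtains Y where "X \<subseteq> Y" "card Y = 2"
proof -
  consider "X = {}" | x where "X = {x}" | "card X = 2"
    using assms(1,2) by (metis card_0_eq card_1_singletonE le_SucE le_zero_eq numeral_2_eq_2 One_nat_def)
  then show thesis
  proof cases
    case 1
    then show ?thesis using that[of "{k, k'}"] assms(3) by simp
  next
    case (2 x)
    then show ?thesis using that[of "{x, k}"] that[of "{x, k'}"] assms(3) by (cases "x = k") auto
  qed (use that in auto)
qed

theorem theorem1p5: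
  fixes n :: nat and G :: "('a, 'b) pre_digraph" and c :: "'a set \<Rightarrow> 'c"
  assumes "n \<ge> 1"
    and "K\<^bsub>n,n\<^esub> G"
    and "local_colouring 2 G c"
  shows "\<exists>P. partition_on (verts G) P \<and> finite P \<and> card P \<le> 3 \<and>
           (\<forall>X \<in> P. \<exists>p. monochromatic_path G c p \<and> set p = X)"
proof -
  obtain U V where UV: "verts G = U \<union> V" "U \<inter> V = {}" "card U = n" "card V = n"
    "arcs_ends G = U \<times> V \<union> V \<times> U"
    using assms(2) unfolding complete_bipartite_digraph_def by blast
  define E where "E = (\<lambda>k u v. (u, v) \<in> arcs_ends G \<and> c {u, v} = k)"
  have fin: "finite U" "finite V" using UV(3,4) assms(1) by (auto intro: card_ge_0_finite)
  interpret bipartite_colouring E U V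
    by unfold_locales (use fin UV(2,5) in \<open>auto simp: E_def insert_commute\<close>)
  have "coverable E 3 (U \<union> V)"
  \<comment> \<open>Padding to two colours requires a type with two colours; otherwise the whole
    colouring is monochromatic.\<close>
  proof (cases "\<exists>k k' :: 'c. k \<noteq> k'")
    case True
    then obtain k k' :: 'c where k: "k \<noteq> k'" by blast
    have "\<forall>v \<in> U \<union> V. \<exists>S. c ` {e \<in> edges G. v \<in> e} \<subseteq> S \<and> card S = 2"
    proof
      fix v assume v: "v \<in> U \<union> V"
      have "finite (c ` {e \<in> edges G. v \<in> e})" "card (c ` {e \<in> edges G. v \<in> e}) \<le> 2"
        using assms(3) v UV(1) by (auto simp: local_colouring_def)
      from obtain_pair_superset[OF this k]
      show "\<exists>S. c ` {e \<in> edges G. v \<in> e} \<subseteq> S \<and> card S = 2" by metis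
    qed
    from bchoice[OF this] obtain S where S: "\<And>v. v \<in> U \<union> V \<Longrightarrow> c ` {e \<in> edges G. v \<in> e} \<subseteq> S v \<and> card (S v) = 2"
      by blast
    interpret two_local_colouring E U V S
    proof
      show "l \<in> S u" if "E l u v" for l u v
      proof -
        have "u \<in> U \<union> V" using E_bip[OF that] by blast
        moreover have "{u, v} \<in> edges G" using that by (auto simp: E_def edges_def)
        ultimately show ?thesis using S that by (auto simp: E_def)
      qed
    qed (use UV S in auto)
    show ?thesis by (rule two_local_coverable)
  next
    case False
    show ?thesis
    proof (rule two_colours_coverable)
      show "E k u v \<or> E k u v" if "u \<in> U" "v \<in> V" for u v and k :: 'c
        using E_total[OF that] False by metis
    qed (use UV in auto)
  qed
  then obtain P where P: "partition_on (verts G) P" "finite P" "card P \<le> 3"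
    "\<forall>X \<in> P. \<exists>k u v. ham_path E k u X v"
    unfolding coverable_def UV(1) by blast
  have "\<exists>p. monochromatic_path G c p \<and> set p = X" if "X \<in> P" for X
  proof -
    have "X \<subseteq> verts G" using P(1) that by (auto simp: partition_on_def)
    then show ?thesis
      using P(4) that ham_path_monochromatic[of G c] unfolding E_def by blast
  qed
  then show ?thesis using P(1-3) by blast
qed

end
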